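(* Let $G$ be a reduced abelian group of finite torsion-free rank, with torsion subgroup $T$. Then $G$ is strongly co-Hopfian if and only if $G$ is strongly Hopfian and $G/T$ is divisible. Likewise, $G$ is uniformly strongly co-Hopfian if and only if $G$ is uniformly strongly Hopfian and $G/T$ is divisible.
   Context: All groups are abelian and written additively. $\mathbb N$ denotes the positive integers. A group $G$ is strongly Hopfian (SH) if for every endomorphism $\phi$ of $G$ there is $n\in\mathbb N$ such that $\phi$ restricted to $\phi^n(G)$ is injective (equivalently, $\ker\phi^n=\ker\phi^m$ for all $m\ge n$); such an $n$ is called an SH-exponent for $\phi$. $G$ is uniformly SH if a single $n\in\mathbb N$ is an SH-exponent for all endomorphisms of $G$. $G$ is strongly co-Hopfian (Sco-H) if for every endomorphism $\phi$ of $G$ there is $n\in\mathbb N$ with $\phi^n(G)=\phi^m(G)$ for all $m\ge n$; it is uniformly Sco-H if a single $n$ works for all endomorphisms of $G$. A group is reduced if it has no nonzero divisible subgroup. The torsion-free rank of $G$ is the rank of $G/T$, i.e. $\dim_{\mathbb Q}(\mathbb Q\otimes G)$. *)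

theory Defs
  imports "HOL-Algebra.Algebra"
begin

text \<open>
  Abelian groups are represented by the locale \<open>comm_group\<close>, whose notation is multiplicative:
  \<open>\<one>\<close> is the zero of the additively written group and \<open>x [^] n\<close> is the multiple \<open>n x\<close>.
  Endomorphisms are the elements of \<open>hom G G\<close>; only their values on \<open>carrier G\<close> matter.
\<close>

definition torsion_subgroup :: "('a, 'b) monoid_scheme \<Rightarrow> 'a set" where
  "torsion_subgroup G = {x \<in> carrier G. \<exists>n::nat. 0 < n \<and> x [^]\<^bsub>G\<^esub> n = \<one>\<^bsub>G\<^esub>}"

definition divisible_group :: "('a, 'b) monoid_scheme \<Rightarrow> bool" where
  "divisible_group G \<longleftrightarrow>
     (\<forall>x \<in> carrier G. \<forall>n::nat. 0 < n \<longrightarrow> (\<exists>y \<in> carrier G. y [^]\<^bsub>G\<^esub> n = x))"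

definition reduced_group :: "('a, 'b) monoid_scheme \<Rightarrow> bool" where
  "reduced_group G \<longleftrightarrow>
     (\<forall>H. subgroup H G \<and> divisible_group (G\<lparr>carrier := H\<rparr>) \<longrightarrow> H = {\<one>\<^bsub>G\<^esub>})"

text \<open>Linear independence over the integers.\<close>

definition int_independent :: "('a, 'b) monoid_scheme \<Rightarrow> 'a set \<Rightarrow> bool" where
  "int_independent G B \<longleftrightarrow> B \<subseteq> carrier G \<and>
     (\<forall>F c. finite F \<and> F \<subseteq> B \<and> finprod G (\<lambda>x. x [^]\<^bsub>G\<^esub> (c x :: int)) F = \<one>\<^bsub>G\<^esub>
        \<longrightarrow> (\<forall>x \<in> F. c x = 0))"

definition max_int_independent :: "('a, 'b) monoid_scheme \<Rightarrow> 'a set \<Rightarrow> bool" where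
  "max_int_independent G B \<longleftrightarrow> int_independent G B \<and>
     (\<forall>B'. int_independent G B' \<and> B \<subseteq> B' \<longrightarrow> B' = B)"

text \<open>
  The rank of a torsion-free abelian group is the cardinality of a maximal independent subset
  (all such subsets have the same cardinality, the dimension of the rational vector space
  obtained by tensoring with the rationals). The torsion-free rank of \<open>G\<close> is the rank of the
  quotient by the torsion subgroup.
\<close>

definition finite_torsion_free_rank :: "('a, 'b) monoid_scheme \<Rightarrow> bool" where
  "finite_torsion_free_rank G \<longleftrightarrow>
     (\<exists>B. finite B \<and> max_int_independent (G Mod torsion_subgroup G) B)"

definition SH_exponent :: "('a, 'b) monoid_scheme \<Rightarrow> ('a \<Rightarrow> 'a) \<Rightarrow> nat \<Rightarrow> bool" where
  "SH_exponent G \<phi> n \<longleftrightarrow> 0 < n \<and> inj_on \<phi> ((\<phi> ^^ n) ` carrier G)"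

definition strongly_Hopfian :: "('a, 'b) monoid_scheme \<Rightarrow> bool" where
  "strongly_Hopfian G \<longleftrightarrow> (\<forall>\<phi> \<in> hom G G. \<exists>n. SH_exponent G \<phi> n)"

definition uniformly_strongly_Hopfian :: "('a, 'b) monoid_scheme \<Rightarrow> bool" where
  "uniformly_strongly_Hopfian G \<longleftrightarrow> (\<exists>n. \<forall>\<phi> \<in> hom G G. SH_exponent G \<phi> n)"

definition ScoH_exponent :: "('a, 'b) monoid_scheme \<Rightarrow> ('a \<Rightarrow> 'a) \<Rightarrow> nat \<Rightarrow> bool" where
  "ScoH_exponent G \<phi> n \<longleftrightarrow>
     0 < n \<and> (\<forall>m \<ge> n. (\<phi> ^^ n) ` carrier G = (\<phi> ^^ m) ` carrier G)"

definition strongly_co_Hopfian :: "('a, 'b) monoid_scheme \<Rightarrow> bool" where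
  "strongly_co_Hopfian G \<longleftrightarrow> (\<forall>\<phi> \<in> hom G G. \<exists>n. ScoH_exponent G \<phi> n)"

definition uniformly_strongly_co_Hopfian :: "('a, 'b) monoid_scheme \<Rightarrow> bool" where
  "uniformly_strongly_co_Hopfian G \<longleftrightarrow> (\<exists>n. \<forall>\<phi> \<in> hom G G. ScoH_exponent G \<phi> n)"

end

theory Submission
  imports Defs
begin

text \<open>
All comments write the group additively. For an endomorphism \<open>\<phi>\<close> and a positive integer \<open>n\<close> put \<open>H = \<phi>\<^sup>n(G)\<close>, so that
\<open>\<phi>(H) \<subseteq> H\<close>. The integer \<open>n\<close> is an SH-exponent iff \<open>\<phi>\<close> is injective on \<open>H\<close>, and an ScoH-exponent iff
\<open>\<phi>(H) = H\<close>. Under either side of the equivalence the two conditions turn out to be the same for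
every \<open>\<phi>\<close> and \<open>n\<close>, which gives the plain and the uniform statement at once. Here \<open>T\<close> is the torsion
subgroup; that \<open>G/T\<close> is divisible if \<open>G\<close> is strongly co-Hopfian follows by applying this property to
the multiplications by integers (\<open>ScoH_imp_divisible_mod_torsion\<close>).

Multiplication by a prime \<open>p\<close> shows that some \<open>p\<^sup>m G\<close> has no \<open>p\<close>-torsion: this is immediate if \<open>G\<close> is
strongly Hopfian; if \<open>G\<close> is strongly co-Hopfian, then \<open>p\<^sup>m G\<close> is \<open>p\<close>-divisible for some \<open>m\<close>, its
\<open>p\<close>-power torsion is therefore divisible, and it vanishes because \<open>G\<close> is reduced
(\<open>reduced_p_divisible_imp_no_p_torsion\<close>).

Next, \<open>G[p]\<close> is finite. Otherwise, for some \<open>k\<close>, the group \<open>(p\<^sup>k G)[p]\<close> is infinite and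
\<open>(p\<^bsup>k+1\<^esup> G)[p]\<close> is finite. A sequence in the former that is independent modulo the latter lifts along
multiplication by \<open>p\<^sup>k\<close> to a basis of a subgroup \<open>A\<close>, a direct sum of infinitely many copies of
\<open>\<int>/p\<^bsup>k+1\<^esup>\<close>, which is a direct summand of \<open>G\<close>. The forward shift of \<open>A\<close> then contradicts the strong
co-Hopfian property and the backward shift the strong Hopfian one
(\<open>infinite_p_torsion_imp_pure_bounded_free\<close>, \<open>pure_bounded_free_imp_not_ScoH\<close>,
\<open>pure_bounded_free_imp_not_SH\<close>). Hence \<open>G[N]\<close> is finite for every positive \<open>N\<close>.

Suppose that \<open>\<phi>\<close> is injective on \<open>H\<close> and that \<open>G/T\<close> is divisible. On the finite groups \<open>H[N]\<close> the map
\<open>\<phi>\<close> is bijective, so the torsion of \<open>H\<close> lies in \<open>\<phi>(H)\<close>. By finite rank a nonzero multiple of any \<open>x \<in> H\<close>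
lies in \<open>\<phi>(H)\<close> (a relation among the \<open>\<phi>\<^sup>i(x)\<close>, \<open>injective_multiple_in_image\<close>); since \<open>H\<close> is divisible
modulo torsion, \<open>x\<close> itself lies in \<open>\<phi>(H)\<close> up to torsion.

Suppose conversely that \<open>\<phi>(H) = H\<close>. By finite rank the kernel of \<open>\<phi>\<close> on \<open>H\<close> is torsion (a relation
among successive preimages, \<open>kernel_orbit_torsion\<close>). If it is nonzero it has an element of prime order
\<open>p\<close>. Since \<open>G = p\<^sup>m G + G[p\<^sup>m]\<close> and \<open>p\<^sup>m G\<close> has no \<open>p\<close>-torsion, this element lies in \<open>\<phi>\<^sup>n(G[p\<^sup>m])\<close>, a
finite group which \<open>\<phi>\<close> maps onto itself, hence injectively; a contradiction.
\<close>

section \<open>Formal integer combinations of a sequence\<close>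

text \<open>
  Integer combinations of a sequence in a group are encoded by homomorphisms from the free abelian
  group on the natural numbers: such an \<open>h\<close> corresponds to the sequence \<open>h (frag_of i)\<close>, and the
  elements of its kernel are the relations between the terms of the sequence.
\<close>

abbreviation free_nat :: "(nat \<Rightarrow>\<^sub>0 int) monoid" where
  "free_nat \<equiv> free_Abelian_group UNIV"

text \<open>
  The forward shift \<open>e\<^sub>i \<mapsto> e\<^bsub>i+1\<^esub>\<close> and, below, the backward shift \<open>e\<^sub>0 \<mapsto> 0\<close>, \<open>e\<^bsub>i+1\<^esub> \<mapsto> e\<^sub>i\<close> on the basis
  \<open>e\<^sub>i = frag_of i\<close>.
\<close>

abbreviation shift :: "(nat \<Rightarrow>\<^sub>0 int) \<Rightarrow> nat \<Rightarrow>\<^sub>0 int" where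
  "shift \<equiv> frag_extend (\<lambda>i. frag_of (Suc i))"

abbreviation unshift :: "(nat \<Rightarrow>\<^sub>0 int) \<Rightarrow> nat \<Rightarrow>\<^sub>0 int" where
  "unshift \<equiv> frag_extend (\<lambda>i. if i = 0 then 0 else frag_of (i - 1))"

lemma lookup_shift:
  "poly_mapping.lookup (shift c) i =
     (case i of 0 \<Rightarrow> 0 | Suc j \<Rightarrow> poly_mapping.lookup c j)"
proof -
  have "Poly_Mapping.keys c \<subseteq> UNIV" by simp
  then show ?thesis
    by (induction c rule: frag_induction)
      (auto simp: frag_extend_diff lookup_minus split: nat.splits)
qed

lemma lookup_unshift: "poly_mapping.lookup (unshift c) i = poly_mapping.lookup c (Suc i)"
proof -
  have "Poly_Mapping.keys c \<subseteq> UNIV" by simp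
  then show ?thesis
    by (induction c rule: frag_induction) (auto simp: frag_extend_diff lookup_minus)
qed

lemma shift_unshift:
  "c = frag_cmul (poly_mapping.lookup c 0) (frag_of 0) + shift (unshift c)"
  by (rule poly_mapping_eqI)
    (auto simp: lookup_add lookup_shift lookup_unshift lookup_one split: nat.splits)

lemma lookup_shift_funpow:
  "i < n \<Longrightarrow> poly_mapping.lookup ((shift ^^ n) c) i = 0"
  by (induction n arbitrary: i) (auto simp: lookup_shift split: nat.splits)

lemma shift_funpow_frag_of:
  "(shift ^^ n) (frag_of i) = frag_of (i + n)"
  by (induction n) auto

lemma carrier_free_nat: "carrier (free_Abelian_group UNIV) = UNIV"
  by (simp add: free_Abelian_group_def)

lemma frag_dvd_imp_cmul:
  assumes "\<And>i. a dvd poly_mapping.lookup c i"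
  obtains d where "c = frag_cmul a d"
proof
  show "c = frag_cmul a (Poly_Mapping.map (\<lambda>n. n div a) c)"
    using assms by (intro poly_mapping_eqI) (auto simp: map.rep_eq when_def)
qed

lemma eventually_zero_lookup: "\<exists>n. \<forall>i\<ge>n. poly_mapping.lookup c i = 0" for c :: "nat \<Rightarrow>\<^sub>0 int"
proof (intro exI allI impI)
  fix i assume "i \<ge> Suc (Max (insert 0 (Poly_Mapping.keys c)))"
  then have "i \<notin> Poly_Mapping.keys c"
    by (metis Max_ge finite_insert finite_keys insertCI not_less_eq_eq)
  then show "poly_mapping.lookup c i = 0" by (simp add: in_keys_iff)
qed

section \<open>Complements of bounded pure subgroups\<close>

context comm_group
begin

lemma inv_mult_cancel [simp]:
  assumes "x \<in> carrier G" "y \<in> carrier G"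
  shows "x \<otimes> inv y \<otimes> y = x" "x \<otimes> y \<otimes> inv y = x"
    "y \<otimes> (inv y \<otimes> x) = x" "inv y \<otimes> (y \<otimes> x) = x"
  using assms by (auto simp: m_assoc) (simp_all add: m_assoc[symmetric])

lemma pow_image_subgroup: "subgroup ((\<lambda>x. x [^] (n::nat)) ` carrier G) G"
proof -
  have "(\<lambda>x. x [^] n) \<in> hom G G"
    by (rule homI) (auto simp: nat_pow_distrib)
  then show ?thesis
    by (meson group_hom.img_is_subgroup group_hom_axioms_def group_hom_def group_axioms)
qed

lemma subgroup_nat_pow_closed:
  "subgroup H G \<Longrightarrow> x \<in> H \<Longrightarrow> x [^] (n::nat) \<in> H"
  by (metis int_pow_int subgroup_int_pow_closed)

lemma set_mult_left_subset: "subgroup A G \<Longrightarrow> subgroup C G \<Longrightarrow> A \<subseteq> A <#> C"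
  by (auto simp: set_mult_def intro!: bexI[of _ _ A] bexI[of _ \<one> C]
      simp: subgroup.mem_carrier subgroup.one_closed)

lemma set_mult_right_subset: "subgroup A G \<Longrightarrow> subgroup C G \<Longrightarrow> C \<subseteq> A <#> C"
  by (auto simp: set_mult_def intro!: bexI[of _ \<one> A]
      simp: subgroup.mem_carrier subgroup.one_closed)

lemma subgroup_chain_Union:
  assumes "\<C> \<noteq> {}" and "\<And>C. C \<in> \<C> \<Longrightarrow> subgroup C G"
    and "\<And>C D. C \<in> \<C> \<Longrightarrow> D \<in> \<C> \<Longrightarrow> C \<subseteq> D \<or> D \<subseteq> C"
  shows "subgroup (\<Union>\<C>) G"
proof (rule subgroupI)
  show "\<Union>\<C> \<subseteq> carrier G" using assms(2) subgroup.subset by blast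
  show "\<Union>\<C> \<noteq> {}" using assms(1,2) subgroup.one_closed by blast
  show "inv a \<in> \<Union>\<C>" if "a \<in> \<Union>\<C>" for a
    using that assms(2) by (auto intro: subgroup.m_inv_closed)
  show "a \<otimes> b \<in> \<Union>\<C>" if "a \<in> \<Union>\<C>" "b \<in> \<Union>\<C>" for a b
  proof -
    from that obtain C D where "C \<in> \<C>" "D \<in> \<C>" "a \<in> C" "b \<in> D" by blast
    with assms(3)[of C D] obtain E where "E \<in> \<C>" "a \<in> E" "b \<in> E" by auto
    then show ?thesis using assms(2) by (auto intro: subgroup.m_closed)
  qed
qed

lemma int_pow_coprime_mem:
  assumes W: "subgroup W G" and x: "x \<in> carrier G" and p: "Factorial_Ring.prime (p::nat)"
    and xp: "x [^] p \<in> W" and xn: "x [^] (n::int) \<in> W" and n: "\<not> int p dvd n"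
  shows "x \<in> W"
proof -
  have "coprime (int p) n" using p n by (simp add: prime_imp_coprime)
  then obtain u v where uv: "u * int p + v * n = 1"
    by (metis bezout_int coprime_iff_gcd_eq_1)
  have "(x [^] int p) [^] u \<otimes> (x [^] n) [^] v \<in> W"
    using W xp xn by (simp add: subgroup.m_closed subgroup_int_pow_closed int_pow_int)
  also have "(x [^] int p) [^] u \<otimes> (x [^] n) [^] v = x [^] (u * int p + v * n)"
    using x by (simp add: int_pow_pow int_pow_mult mult.commute)
  finally show ?thesis using x uv by (simp add: int_pow_1)
qed

text \<open>
  A subgroup \<open>A\<close> that meets \<open>q G\<close> trivially, where \<open>q = p\<^bsup>k+1\<^esup>\<close>, and whose elements killed by \<open>p\<^sup>k\<close> are
  \<open>p\<close>-fold multiples within \<open>A\<close>, is a direct summand. Any subgroup \<open>C\<close> maximal among those that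
  contain \<open>q G\<close> and meet \<open>A\<close> trivially is a complement.
\<close>

lemma bounded_pure_complement:
  assumes A: "subgroup A G" and p: "Factorial_Ring.prime (p::nat)"
    and bd: "A \<inter> (\<lambda>x. x [^] (p ^ Suc k)) ` carrier G = {\<one>}"
    and pure: "\<And>a. a \<in> A \<Longrightarrow> a [^] (p ^ k) = \<one> \<Longrightarrow> \<exists>b\<in>A. b [^] p = a"
  obtains C where "subgroup C G" "A \<inter> C = {\<one>}" "carrier G = A <#> C"
proof -
  define Q where "Q = (\<lambda>x. x [^] (p ^ Suc k)) ` carrier G"
  define \<A> where "\<A> = {C. subgroup C G \<and> Q \<subseteq> C \<and> A \<inter> C = {\<one>}}"
  have "\<exists>M\<in>\<A>. \<forall>D\<in>\<A>. M \<subseteq> D \<longrightarrow> D = M"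
  proof (rule subset_Zorn_nonempty)
    have "Q \<in> \<A>"
      using bd pow_image_subgroup[of "p ^ Suc k"] unfolding \<A>_def Q_def by simp
    then show "\<A> \<noteq> {}" by blast
    fix \<C> assume ne: "\<C> \<noteq> {}" and ch: "subset.chain \<A> \<C>"
    then have sub: "\<C> \<subseteq> \<A>" and lin: "\<And>C D. C \<in> \<C> \<Longrightarrow> D \<in> \<C> \<Longrightarrow> C \<subseteq> D \<or> D \<subseteq> C"
      by (auto simp: subset_chain_def)
    have "subgroup (\<Union>\<C>) G"
      using ne lin sub by (intro subgroup_chain_Union) (auto simp: \<A>_def)
    then show "\<Union>\<C> \<in> \<A>"
      using ne sub by (fastforce simp: \<A>_def)
  qed
  then obtain C where "C \<in> \<A>" and max: "\<And>D. D \<in> \<A> \<Longrightarrow> C \<subseteq> D \<Longrightarrow> D = C" by blast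
  then have C: "subgroup C G" and QC: "Q \<subseteq> C" and AC: "A \<inter> C = {\<one>}"
    by (auto simp: \<A>_def)
  let ?S = "A <#> C"
  have S: "subgroup ?S G" by (rule mult_subgroups[OF A C])
  note AS = set_mult_left_subset[OF A C] and CS = set_mult_right_subset[OF A C]
  note car = subgroup.mem_carrier[OF A] subgroup.mem_carrier[OF C]
  have "carrier G \<subseteq> ?S"
  proof (rule ccontr)
    assume "\<not> carrier G \<subseteq> ?S"
    then obtain x where x: "x \<in> carrier G" "x \<notin> ?S" by blast
    have "x [^] (p ^ Suc k) \<in> ?S" using x QC CS by (auto simp: Q_def)
    then have ex: "\<exists>i. x [^] (p ^ i) \<in> ?S" by blast
    \<comment> \<open>The last multiple \<open>p\<^sup>j x\<close> outside \<open>A + C\<close> replaces \<open>x\<close>.\<close>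
    define i where "i = (LEAST i. x [^] (p ^ i) \<in> ?S)"
    have i: "x [^] (p ^ i) \<in> ?S" unfolding i_def using ex by (rule LeastI_ex)
    have "i \<noteq> 0" using i x by (metis nat_pow_eone power_0)
    then obtain j where j: "i = Suc j" by (cases i) auto
    define y where "y = x [^] (p ^ j)"
    have y: "y \<in> carrier G" using x by (simp add: y_def)
    have yS: "y \<notin> ?S" using not_less_Least[of j "\<lambda>i. x [^] (p ^ i) \<in> ?S"] j
      by (auto simp: y_def i_def)
    have "y [^] p \<in> ?S" using i x by (simp add: y_def j nat_pow_pow mult.commute)
    then obtain a c where ac: "a \<in> A" "c \<in> C" "y [^] p = a \<otimes> c"
      by (auto simp: set_mult_def)
    have "y [^] (p ^ Suc k) = a [^] (p ^ k) \<otimes> c [^] (p ^ k)"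
      using ac y car by (simp add: nat_pow_pow[symmetric] nat_pow_distrib)
    moreover have "y [^] (p ^ Suc k) \<in> C" using QC y by (auto simp: Q_def)
    ultimately have "a [^] (p ^ k) \<in> C"
      using subgroup.m_closed[OF C, of "y [^] (p ^ Suc k)" "inv (c [^] (p ^ k))"] ac car C
      by (simp add: subgroup_nat_pow_closed subgroup.m_inv_closed)
    then have "a [^] (p ^ k) = \<one>"
      using AC subgroup_nat_pow_closed[OF A ac(1)] by blast
    then obtain b where b: "b \<in> A" "b [^] p = a" using pure ac by blast
    \<comment> \<open>Since \<open>b \<in> A\<close>, the difference \<open>z\<close> stays outside \<open>A + C\<close>, while \<open>p z\<close> now lies in \<open>C\<close>.\<close>
    define z where "z = y \<otimes> inv b"
    have z: "z \<in> carrier G" using y b car by (simp add: z_def)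
    have zp: "z [^] p = c"
    proof -
      have "z [^] p = y [^] p \<otimes> inv a"
        using y b car by (simp add: z_def nat_pow_distrib nat_pow_inv)
      also have "\<dots> = c" using ac car by (simp add: m_comm[of a c])
      finally show ?thesis .
    qed
    have zS: "z \<notin> ?S"
    proof
      assume "z \<in> ?S"
      then have "z \<otimes> b \<in> ?S" using S AS b by (meson subgroup.m_closed subsetD)
      then show False using yS y b car by (simp add: z_def)
    qed
    \<comment> \<open>Then \<open>C\<close> enlarged by \<open>z\<close> still meets \<open>A\<close> trivially, against the maximality of \<open>C\<close>.\<close>
    let ?Z = "generate G {z}"
    have Z: "subgroup ?Z G" using z by (intro generate_is_subgroup) auto
    let ?C' = "C <#> ?Z"
    have "?C' \<in> \<A>"
    proof -
      have "A \<inter> ?C' \<subseteq> {\<one>}"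
      proof
        fix w assume w: "w \<in> A \<inter> ?C'"
        then obtain d n where d: "d \<in> C" "w = d \<otimes> z [^] (n::int)"
          using z by (auto simp: set_mult_def generate_pow)
        show "w \<in> {\<one>}"
        proof (cases "int p dvd n")
          case True
          then obtain m where "n = int p * m" by blast
          then have "z [^] n = c [^] m" using z zp by (metis int_pow_int int_pow_pow)
          then have "w \<in> C" using d C ac by (simp add: subgroup.m_closed subgroup_int_pow_closed)
          then show ?thesis using w AC by blast
        next
          case False
          have "z [^] n = inv d \<otimes> w" using d z car by simp
          then have "z [^] n \<in> ?S"
            using d w S AS CS by (metis IntD1 subgroup.m_closed subgroup.m_inv_closed subsetD)
          moreover have "z [^] p \<in> ?S" using zp ac CS by blast
          ultimately have "z \<in> ?S" using int_pow_coprime_mem[OF S z p] False by blast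
          with zS show ?thesis by blast
        qed
      qed
      moreover have "\<one> \<in> A \<inter> ?C'"
        using subgroup.one_closed[OF A] subgroup.one_closed[OF mult_subgroups[OF C Z]] by blast
      ultimately show ?thesis
        using mult_subgroups[OF C Z] QC set_mult_left_subset[OF C Z] by (auto simp: \<A>_def)
    qed
    then have "?C' = C" using max set_mult_left_subset[OF C Z] by blast
    moreover have "z \<in> ?C'"
      using set_mult_right_subset[OF C Z] generate.incl[of z "{z}" G] by blast
    ultimately show False using zS CS by blast
  qed
  then have "carrier G = ?S" using subgroup.subset[OF S] by blast
  with that C AC show ?thesis by blast
qed

lemma complement_projection:
  assumes A: "subgroup A G" and C: "subgroup C G" and AC: "A \<inter> C = {\<one>}"
    and G: "carrier G = A <#> C"
  obtains \<pi> where "\<pi> \<in> hom G G" "\<pi> ` carrier G \<subseteq> A" "\<And>a. a \<in> A \<Longrightarrow> \<pi> a = a"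
proof -
  note car = subgroup.mem_carrier[OF A] subgroup.mem_carrier[OF C]
  have ex: "\<exists>a. a \<in> A \<and> x \<otimes> inv a \<in> C" if "x \<in> carrier G" for x
  proof -
    from that G obtain a c where ac: "a \<in> A" "c \<in> C" "x = a \<otimes> c" by (auto simp: set_mult_def)
    then have "x \<otimes> inv a = c" using car by (simp add: m_comm[of a c])
    with ac show ?thesis by auto
  qed
  define \<pi> where "\<pi> x = (SOME a. a \<in> A \<and> x \<otimes> inv a \<in> C)" for x
  have \<pi>: "\<pi> x \<in> A" "x \<otimes> inv (\<pi> x) \<in> C" if "x \<in> carrier G" for x
    using someI_ex[OF ex[OF that]] by (auto simp: \<pi>_def)
  have uniq: "\<pi> x = a" if "x \<in> carrier G" "a \<in> A" "x \<otimes> inv a \<in> C" for x a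
  proof -
    note c = \<pi>[OF that(1)]
    have "(x \<otimes> inv (\<pi> x)) \<otimes> inv (x \<otimes> inv a) = a \<otimes> inv (\<pi> x)"
      using that c car by (simp add: inv_mult m_ac)
    moreover have "(x \<otimes> inv (\<pi> x)) \<otimes> inv (x \<otimes> inv a) \<in> C"
      using that c C by (simp add: subgroup.m_closed subgroup.m_inv_closed)
    moreover have "a \<otimes> inv (\<pi> x) \<in> A"
      using that c A by (simp add: subgroup.m_closed subgroup.m_inv_closed)
    ultimately have "a \<otimes> inv (\<pi> x) = \<one>" using AC by auto
    then show ?thesis using that c car by (metis inv_equality inv_inv m_comm inv_closed)
  qed
  show ?thesis
  proof
    show "\<pi> \<in> hom G G"
    proof (rule homI)
      show "\<pi> x \<in> carrier G" if "x \<in> carrier G" for x using \<pi>[OF that] car by blast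
      fix x y assume xy: "x \<in> carrier G" "y \<in> carrier G"
      have "x \<otimes> y \<otimes> inv (\<pi> x \<otimes> \<pi> y) = (x \<otimes> inv (\<pi> x)) \<otimes> (y \<otimes> inv (\<pi> y))"
        using xy \<pi> car by (simp add: inv_mult m_ac)
      then show "\<pi> (x \<otimes> y) = \<pi> x \<otimes> \<pi> y"
        using xy \<pi> A C by (intro uniq) (auto simp: subgroup.m_closed)
    qed
    show "\<pi> ` carrier G \<subseteq> A" using \<pi> by blast
    show "\<pi> a = a" if "a \<in> A" for a
      using that car subgroup.one_closed[OF C] by (intro uniq) auto
  qed
qed

section \<open>Shifts on bounded free summands\<close>

lemma free_nat_hom:
  assumes "h \<in> hom free_nat G"
  shows "h c \<in> carrier G" "h 0 = \<one>" "h (c + d) = h c \<otimes> h d"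
    "h (frag_cmul n c) = h c [^] n" "h (c - d) = h c \<otimes> inv h d"
proof -
  interpret F: comm_group free_nat by (rule abelian_free_Abelian_group)
  interpret h: group_hom free_nat G h
    using assms by unfold_locales
  show c: "h c \<in> carrier G" for c using h.hom_closed[of c] by simp
  show "h 0 = \<one>" using h.hom_one by simp
  show add: "h (c + d) = h c \<otimes> h d" for c d using h.hom_mult[of c d] by simp
  show pow: "h (frag_cmul n c) = h c [^] n" for n c
    using h.hom_int_pow[of c n] by simp
  have "h (c - d) = h c \<otimes> h (frag_cmul (-1) d)" using add[of c "-d"] by simp
  then show "h (c - d) = h c \<otimes> inv h d" by (simp only: pow c int_pow_neg int_pow_1)
qed

lemma free_nat_hom_range_subgroup:
  "h \<in> hom free_nat G \<Longrightarrow> subgroup (range h) G"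
  using group_hom.img_is_subgroup[of free_nat G h]
  by (simp add: group_hom_def group_hom_axioms_def carrier_free_nat)

lemma free_nat_hom_eqI:
  assumes "h \<in> hom free_nat G" "g \<in> hom free_nat G"
    and "\<And>i. h (frag_of i) = g (frag_of i)"
  shows "h c = g c"
proof -
  have "Poly_Mapping.keys c \<subseteq> UNIV" by simp
  then show ?thesis
    by (induction c rule: frag_induction) (auto simp: assms free_nat_hom)
qed

lemma free_nat_hom_comp: "h \<in> hom free_nat G \<Longrightarrow> (\<lambda>c. h (frag_extend f c)) \<in> hom free_nat G"
  by (rule homI) (auto simp: frag_extend_add free_nat_hom)

lemma free_nat_hom_obtain:
  assumes "\<And>i. x i \<in> carrier G"
  obtains h where "h \<in> hom free_nat G" "\<And>i. h (frag_of i) = x i"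
  using free_Abelian_group_universal[of x UNIV] assms by auto

text \<open>
  With \<open>q = p\<^bsup>k+1\<^esup>\<close>, the image of \<open>h\<close> has exponent \<open>q\<close>, and a combination lies in \<open>q G\<close> only if all its
  coefficients are divisible by \<open>q\<close>. So \<open>h\<close> induces an embedding of a countably infinite direct sum of
  copies of \<open>\<int>/q\<close> onto a subgroup that meets \<open>q G\<close> trivially.
\<close>

definition pure_bounded_free :: "nat \<Rightarrow> nat \<Rightarrow> ((nat \<Rightarrow>\<^sub>0 int) \<Rightarrow> 'a) \<Rightarrow> bool" where
  "pure_bounded_free p k h \<longleftrightarrow> h \<in> hom free_nat G \<and>
     (\<forall>c. h c [^] (p ^ Suc k) = \<one>) \<and>
     (\<forall>c. h c \<in> (\<lambda>x. x [^] (p ^ Suc k)) ` carrier G \<longrightarrow> (\<exists>d. c = frag_cmul (int (p ^ Suc k)) d))"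

text \<open>
  The image of \<open>h\<close> is a direct summand, so an endomorphism of the free group on the natural numbers,
  given by its values \<open>f i\<close> on the basis, induces an endomorphism of the whole group into that image.
\<close>

lemma extend_frag_endomorphism:
  assumes p: "Factorial_Ring.prime (p::nat)" and h: "pure_bounded_free p k h"
  obtains \<phi> where "\<phi> \<in> hom G G" "\<phi> ` carrier G \<subseteq> range h" "\<And>c. \<phi> (h c) = h (frag_extend f c)"
proof -
  have hom: "h \<in> hom free_nat G" and tor: "\<And>c. h c [^] (p ^ Suc k) = \<one>"
    and indep: "\<And>c. h c \<in> (\<lambda>x. x [^] (p ^ Suc k)) ` carrier G \<Longrightarrow> \<exists>d. c = frag_cmul (int (p ^ Suc k)) d"
    using h by (auto simp: pure_bounded_free_def)
  have one: "\<one> \<in> (\<lambda>x. x [^] (p ^ Suc k)) ` carrier G"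
    by (rule image_eqI[of _ _ \<one>]) (simp_all del: power_Suc)
  have npow: "h (frag_cmul (int n) c) = h c [^] n" for n c
    by (simp add: free_nat_hom[OF hom] int_pow_int)
  let ?A = "range h"
  have A: "subgroup ?A G" by (rule free_nat_hom_range_subgroup[OF hom])
  have "?A \<inter> (\<lambda>x. x [^] (p ^ Suc k)) ` carrier G \<subseteq> {\<one>}"
  proof
    fix a assume "a \<in> ?A \<inter> (\<lambda>x. x [^] (p ^ Suc k)) ` carrier G"
    then obtain c where a: "a = h c" "h c \<in> (\<lambda>x. x [^] (p ^ Suc k)) ` carrier G" by blast
    then obtain d where "c = frag_cmul (int (p ^ Suc k)) d" using indep by blast
    then show "a \<in> {\<one>}" unfolding a by (simp only: npow tor insertI1)
  qed
  then have bd: "?A \<inter> (\<lambda>x. x [^] (p ^ Suc k)) ` carrier G = {\<one>}"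
    using one subgroup.one_closed[OF A] by blast
  have pure: "\<exists>b\<in>?A. b [^] p = a" if a: "a \<in> ?A" "a [^] (p ^ k) = \<one>" for a
  proof -
    from a obtain c where c: "a = h c" by blast
    then have "h (frag_cmul (int (p ^ k)) c) \<in> (\<lambda>x. x [^] (p ^ Suc k)) ` carrier G"
      unfolding npow using a(2) one by simp
    then obtain d where d: "frag_cmul (int (p ^ k)) c = frag_cmul (int (p ^ Suc k)) d"
      using indep by blast
    have "c = frag_cmul (int p) d"
    proof (rule poly_mapping_eqI)
      fix i
      have "int (p ^ k) * poly_mapping.lookup c i = int (p ^ Suc k) * poly_mapping.lookup d i"
        using arg_cong[OF d, of "\<lambda>c. poly_mapping.lookup c i"] by simp
      then show "poly_mapping.lookup c i = poly_mapping.lookup (frag_cmul (int p) d) i"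
        using p by (auto simp: prime_gt_0_nat)
    qed
    then have "a = h d [^] p" using c npow by simp
    then show ?thesis by blast
  qed
  obtain C where "subgroup C G" "?A \<inter> C = {\<one>}" "carrier G = ?A <#> C"
    using bounded_pure_complement[OF A p bd pure] by blast
  with A obtain \<pi> where \<pi>: "\<pi> \<in> hom G G" "\<pi> ` carrier G \<subseteq> ?A" "\<And>a. a \<in> ?A \<Longrightarrow> \<pi> a = a"
    using complement_projection by blast
  \<comment> \<open>The value does not depend on the chosen representative: two of them differ by a multiple of \<open>q\<close>.\<close>
  define s where "s a = h (frag_extend f (SOME c. h c = a))" for a
  have s: "s (h c) = h (frag_extend f c)" for c
  proof -
    define c' where "c' = (SOME c'. h c' = h c)"
    have "h c' = h c" unfolding c'_def by (rule someI[of _ c]) simp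
    then have "h (c' - c) = \<one>" by (simp add: free_nat_hom[OF hom])
    then obtain d where "c' - c = frag_cmul (int (p ^ Suc k)) d" using indep one by metis
    then have c': "c' = c + frag_cmul (int (p ^ Suc k)) d" by (metis add.commute diff_add_cancel)
    have "h (frag_extend f c') = h (frag_extend f c) \<otimes> h (frag_extend f d) [^] (p ^ Suc k)"
      unfolding c' by (simp only: frag_extend_add frag_extend_cmul free_nat_hom(3)[OF hom] npow)
    also have "\<dots> = h (frag_extend f c)" by (simp only: tor r_one free_nat_hom(1)[OF hom])
    finally show ?thesis by (simp add: s_def c'_def)
  qed
  show ?thesis
  proof
    show "s \<circ> \<pi> \<in> hom G G"
    proof (rule homI)
      fix x y assume xy: "x \<in> carrier G" "y \<in> carrier G"
      then obtain c d where cd: "\<pi> x = h c" "\<pi> y = h d" using \<pi>(2) by blast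
      show "(s \<circ> \<pi>) x \<in> carrier G" by (simp add: cd s free_nat_hom[OF hom])
      have "\<pi> (x \<otimes> y) = h (c + d)"
        using \<pi>(1) xy cd by (simp add: hom_mult free_nat_hom[OF hom])
      then show "(s \<circ> \<pi>) (x \<otimes> y) = (s \<circ> \<pi>) x \<otimes> (s \<circ> \<pi>) y"
        by (simp add: s cd frag_extend_add free_nat_hom(3)[OF hom, symmetric])
    qed
    show "(s \<circ> \<pi>) ` carrier G \<subseteq> range h"
      by (auto simp: s_def)
    show "(s \<circ> \<pi>) (h c) = h (frag_extend f c)" for c
      by (simp add: \<pi>(3) s)
  qed
qed

lemma pure_bounded_free_frag_of_eq:
  assumes p: "Factorial_Ring.prime (p::nat)" and h: "pure_bounded_free p k h"
    and eq: "h (frag_of i) = h c"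
  shows "poly_mapping.lookup c i \<noteq> 0"
proof
  assume 0: "poly_mapping.lookup c i = 0"
  have hom: "h \<in> hom free_nat G" using h by (auto simp: pure_bounded_free_def)
  have "h (frag_of i - c) = \<one> [^] (p ^ Suc k)"
    unfolding free_nat_hom(5)[OF hom] eq using free_nat_hom(1)[OF hom] by (simp del: power_Suc)
  then have "h (frag_of i - c) \<in> (\<lambda>x. x [^] (p ^ Suc k)) ` carrier G" by blast
  then obtain d where "frag_of i - c = frag_cmul (int (p ^ Suc k)) d"
    using h unfolding pure_bounded_free_def by blast
  from arg_cong[OF this, of "\<lambda>c. poly_mapping.lookup c i"]
  have "1 = int (p ^ Suc k) * poly_mapping.lookup d i" by (simp add: lookup_minus 0)
  then have "int p dvd 1" by (metis dvd_mult2 dvd_triv_left of_nat_mult power_Suc)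
  with p show False using prime_gt_1_nat[of p] by simp
qed

lemma pure_bounded_free_imp_not_ScoH:
  assumes p: "Factorial_Ring.prime (p::nat)" and h: "pure_bounded_free p k h"
  shows "\<not> strongly_co_Hopfian G"
proof
  assume S: "strongly_co_Hopfian G"
  obtain \<phi> where \<phi>: "\<phi> \<in> hom G G" "\<phi> ` carrier G \<subseteq> range h" "\<And>c. \<phi> (h c) = h (shift c)"
    using extend_frag_endomorphism[OF p h] by blast
  have pow: "(\<phi> ^^ n) (h c) = h ((shift ^^ n) c)" for n c
    by (induction n) (auto simp: \<phi>(3))
  have car: "h c \<in> carrier G" for c using h free_nat_hom(1) by (auto simp: pure_bounded_free_def)
  obtain n where n: "ScoH_exponent G \<phi> n" using S \<phi>(1) by (auto simp: strongly_co_Hopfian_def)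
  have "h (frag_of n) = (\<phi> ^^ n) (h (frag_of 0))"
    by (simp only: pow shift_funpow_frag_of add_0)
  then have "h (frag_of n) \<in> (\<phi> ^^ n) ` carrier G" using car by blast
  also have "\<dots> = (\<phi> ^^ (Suc (Suc n))) ` carrier G"
    using n unfolding ScoH_exponent_def by (metis le_Suc_eq order_refl)
  finally obtain g where g: "g \<in> carrier G" "h (frag_of n) = (\<phi> ^^ Suc n) (\<phi> g)"
    by (auto simp: funpow_swap1)
  then obtain c where "\<phi> g = h c" using \<phi>(2) by blast
  with g have "h (frag_of n) = h ((shift ^^ Suc n) c)" by (simp only: pow)
  from pure_bounded_free_frag_of_eq[OF p h this] show False
    using lookup_shift_funpow[of n "Suc n" c] by blast
qed

lemma pure_bounded_free_imp_not_SH: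
  assumes p: "Factorial_Ring.prime (p::nat)" and h: "pure_bounded_free p k h"
  shows "\<not> strongly_Hopfian G"
proof
  assume S: "strongly_Hopfian G"
  obtain \<phi> where \<phi>: "\<phi> \<in> hom G G" "\<phi> ` carrier G \<subseteq> range h" "\<And>c. \<phi> (h c) = h (unshift c)"
    using extend_frag_endomorphism[OF p h] by blast
  have hom: "h \<in> hom free_nat G" using h by (simp add: pure_bounded_free_def)
  have pow: "(\<phi> ^^ n) (h (frag_of n)) = h (frag_of 0)" for n
    by (induction n) (auto simp: \<phi>(3) funpow_swap1)
  obtain n where n: "inj_on \<phi> ((\<phi> ^^ n) ` carrier G)"
    using S \<phi>(1) by (auto simp: strongly_Hopfian_def SH_exponent_def)
  have "h (frag_of 0) \<in> (\<phi> ^^ n) ` carrier G"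
    using pow[of n] free_nat_hom(1)[OF hom] by (metis imageI)
  moreover have "(\<phi> ^^ n) (h 0) = h 0" by (induction n) (auto simp: \<phi>(3))
  then have "h 0 \<in> (\<phi> ^^ n) ` carrier G" using free_nat_hom(1)[OF hom] by (metis imageI)
  moreover have "\<phi> (h (frag_of 0)) = \<phi> (h 0)"
    unfolding \<phi>(3) frag_extend_of frag_extend_0 by simp
  ultimately have "h (frag_of 0) = h 0" using n by (meson inj_onD)
  from pure_bounded_free_frag_of_eq[OF p h this] show False by simp
qed

section \<open>Infinite p-torsion yields a bounded free summand\<close>

lemma finite_generate_singleton:
  assumes x: "x \<in> carrier G" and p: "p > 0" "x [^] (p::nat) = \<one>"
  shows "finite (generate G {x})"
proof -
  have "generate G {x} \<subseteq> (\<lambda>i. x [^] i) ` {0..<int p}"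
  proof
    fix y assume "y \<in> generate G {x}"
    then obtain k where k: "y = x [^] (k::int)" using x by (auto simp: generate_pow)
    have "x [^] k = x [^] (int p * (k div int p) + k mod int p)" by simp
    also have "\<dots> = (x [^] int p) [^] (k div int p) \<otimes> x [^] (k mod int p)"
      using x by (simp only: int_pow_mult int_pow_pow)
    also have "x [^] int p = \<one>" using p by (simp add: int_pow_int)
    finally have "y = x [^] (k mod int p)" using x k by simp
    then show "y \<in> (\<lambda>i. x [^] i) ` {0..<int p}" using p by auto
  qed
  then show ?thesis by (rule finite_subset) simp
qed

lemma finite_set_mult: "finite A \<Longrightarrow> finite B \<Longrightarrow> finite (A <#> B)"
  by (auto simp: set_mult_def)

text \<open>
  An infinite elementary abelian \<open>p\<close>-group contains a sequence that is linearly independent, over the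
  field with \<open>p\<close> elements, modulo a given finite subgroup \<open>N\<close>. The term \<open>e n\<close> is chosen outside the finite
  subgroup \<open>W n\<close> generated by \<open>N\<close> and the earlier terms.
\<close>

lemma independent_sequence_modulo_finite:
  assumes p: "Factorial_Ring.prime (p::nat)"
    and V: "subgroup V G" "infinite V" "\<And>x. x \<in> V \<Longrightarrow> x [^] p = \<one>"
    and N: "subgroup N G" "finite N" "N \<subseteq> V"
  obtains e where "\<And>i::nat. e i \<in> V"
    "\<And>h c. h \<in> hom free_nat G \<Longrightarrow> (\<And>i. h (frag_of i) = e i) \<Longrightarrow> h c \<in> N \<Longrightarrow>
      \<exists>d. c = frag_cmul (int p) d"
proof -
  define P where "P We \<longleftrightarrow> (case We of (W, e) \<Rightarrow>
     subgroup W G \<and> finite W \<and> W \<subseteq> V \<and> N \<subseteq> W \<and> e \<in> V - W)" for We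
  define Q where "Q We We' \<longleftrightarrow> (fst We \<subseteq> fst We' \<and> snd We \<in> fst We')" for We We' :: "'a set \<times> 'a"
  have "\<exists>f. \<forall>n::nat. P (f n) \<and> Q (f n) (f (Suc n))"
  proof (rule dependent_nat_choice)
    have "\<not> V \<subseteq> N" using V(2) N(2) finite_subset by blast
    then obtain e where "e \<in> V - N" by blast
    then have "P (N, e)" using N by (simp add: P_def)
    then show "\<exists>We. P We" by blast
  next
    fix We :: "'a set \<times> 'a" and n :: nat assume "P We"
    then obtain W e where We: "We = (W, e)" and W: "subgroup W G" "finite W" "W \<subseteq> V" "N \<subseteq> W"
      and e: "e \<in> V" "e \<notin> W"
      by (cases We) (auto simp: P_def)
    have ec: "e \<in> carrier G" using e subgroup.mem_carrier[OF V(1)] by simp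
    have Z: "subgroup (generate G {e}) G" using ec by (intro generate_is_subgroup) auto
    let ?W = "W <#> generate G {e}"
    have sub: "subgroup ?W G" by (rule mult_subgroups[OF W(1) Z])
    have fin: "finite ?W"
      using finite_generate_singleton[OF ec prime_gt_0_nat[OF p] V(3)[OF e(1)]] W(2)
      by (intro finite_set_mult)
    have "generate G {e} \<subseteq> V" using generate_subgroup_incl[of "{e}" V] e V(1) by blast
    then have WV: "?W \<subseteq> V" using W(3) V(1) by (auto simp: set_mult_def intro!: subgroup.m_closed)
    have "\<not> V \<subseteq> ?W" using V(2) fin finite_subset by blast
    then obtain e' where e': "e' \<in> V - ?W" by blast
    have "e \<in> ?W"
      using set_mult_right_subset[OF W(1) Z] generate.incl[of e "{e}" G] by blast
    then have "P (?W, e') \<and> Q We (?W, e')"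
      using sub fin WV e' W(4) set_mult_left_subset[OF W(1) Z] by (auto simp: P_def Q_def We)
    then show "\<exists>We'. P We' \<and> Q We We'" by blast
  qed
  then obtain f where f: "\<And>n. P (f n)" "\<And>n. Q (f n) (f (Suc n))" by blast
  define W where "W n = fst (f n)" for n
  define e where "e n = snd (f n)" for n
  have W: "subgroup (W n) G" "N \<subseteq> W n" "e n \<in> V" "e n \<notin> W n" for n
    using f(1)[of n] by (auto simp: P_def W_def e_def split: prod.splits)
  have step: "W n \<subseteq> W (Suc n)" "e n \<in> W (Suc n)" for n
    using f(2)[of n] by (auto simp: Q_def W_def e_def)
  have ec: "e n \<in> carrier G" for n using W(3) subgroup.mem_carrier[OF V(1)] by simp
  have "\<exists>d. c = frag_cmul (int p) d"
    if hom: "h \<in> hom free_nat G" and he: "\<And>i. h (frag_of i) = e i" and hN: "h c \<in> N" for h c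
  proof -
    have hV: "h c \<in> V" for c
    proof -
      have "Poly_Mapping.keys c \<subseteq> UNIV" by simp
      then show ?thesis
        by (induction c rule: frag_induction)
          (auto simp: free_nat_hom[OF hom] he W V(1) subgroup.one_closed subgroup.m_closed
            subgroup.m_inv_closed)
    qed
    have split: "h c = h (c - frag_cmul a (frag_of n)) \<otimes> e n [^] a" for c a n
      by (simp add: free_nat_hom[OF hom] he ec)
    have hW: "h c \<in> W n" if "\<And>i. i \<ge> n \<Longrightarrow> int p dvd poly_mapping.lookup c i" for n c
      using that
    proof (induction n arbitrary: c)
      case 0
      then obtain d where "c = frag_cmul (int p) d" by (metis frag_dvd_imp_cmul le0)
      then have "h c = \<one>" by (simp add: free_nat_hom[OF hom] int_pow_int V(3) hV)
      then show ?case using W(1)[of 0] by (simp add: subgroup.one_closed)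
    next
      case (Suc n)
      let ?a = "poly_mapping.lookup c n"
      have "h (c - frag_cmul ?a (frag_of n)) \<in> W n"
        using Suc.prems by (intro Suc.IH) (auto simp: lookup_minus Suc_le_eq)
      then show ?case
        using split[of c ?a n] W(1)[of "Suc n"] step[of n]
        by (metis subgroup.m_closed subgroup_int_pow_closed subsetD)
    qed
    have main: "int p dvd poly_mapping.lookup c j"
      if "\<And>i. i \<ge> n \<Longrightarrow> int p dvd poly_mapping.lookup c i" for n j
      using that
    proof (induction n)
      case (Suc n)
      let ?a = "poly_mapping.lookup c n"
      let ?c = "c - frag_cmul ?a (frag_of n)"
      have hc: "h ?c \<in> W n"
        using Suc.prems by (intro hW) (auto simp: lookup_minus Suc_le_eq)
      have "h c \<in> W n" using hN W(2) by blast
      then have "inv (h ?c) \<otimes> h c \<in> W n"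
        using hc W(1)[of n] by (simp add: subgroup.m_closed subgroup.m_inv_closed)
      also have "inv (h ?c) \<otimes> h c = e n [^] ?a"
        unfolding split[of c ?a n] using ec free_nat_hom(1)[OF hom] by simp
      finally have "e n [^] ?a \<in> W n" .
      moreover have "e n [^] p \<in> W n" using V(3) W by (simp add: subgroup.one_closed)
      ultimately have "int p dvd ?a" using int_pow_coprime_mem[OF W(1) ec p] W(4) by blast
      then show ?case using Suc by (metis le_antisym not_less_eq_eq)
    qed simp
    obtain n where "\<forall>i\<ge>n. poly_mapping.lookup c i = 0" using eventually_zero_lookup by blast
    then have "int p dvd poly_mapping.lookup c j" for j using main[of n j] by simp
    then show ?thesis by (metis frag_dvd_imp_cmul)
  qed
  with W(3) that show ?thesis by blast
qed

text \<open>
  If \<open>G[p]\<close> is infinite while \<open>(p\<^sup>m G)[p]\<close> is trivial, then \<open>G\<close> has bounded free summands of infinite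
  rank.
\<close>

lemma infinite_p_torsion_imp_pure_bounded_free:
  assumes p: "Factorial_Ring.prime (p::nat)" and inf: "infinite {x \<in> carrier G. x [^] p = \<one>}"
    and m: "\<And>x. x \<in> carrier G \<Longrightarrow> (x [^] (p ^ m)) [^] p = \<one> \<Longrightarrow> x [^] (p ^ m) = \<one>"
  obtains k h where "pure_bounded_free p k h"
proof -
  define V where "V k = {x \<in> (\<lambda>x. x [^] (p ^ k)) ` carrier G. x [^] p = \<one>}" for k
  have V: "subgroup (V k) G" for k
  proof -
    note S = pow_image_subgroup[of "p ^ k"]
    show ?thesis
    proof (rule subgroupI)
      show "V k \<subseteq> carrier G" by (auto simp: V_def)
      have "\<one> \<in> V k" using subgroup.one_closed[OF S] by (simp add: V_def)
      then show "V k \<noteq> {}" by blast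
      show "inv a \<in> V k" if "a \<in> V k" for a
        using that subgroup.m_inv_closed[OF S] subgroup.mem_carrier[OF S]
        by (auto simp: V_def nat_pow_inv)
      show "a \<otimes> b \<in> V k" if "a \<in> V k" "b \<in> V k" for a b
        using that subgroup.m_closed[OF S] subgroup.mem_carrier[OF S]
        by (auto simp: V_def nat_pow_distrib)
    qed
  qed
  have V0: "V 0 = {x \<in> carrier G. x [^] p = \<one>}" by (auto simp: V_def image_iff)
  have "V m \<subseteq> {\<one>}" using m by (auto simp: V_def)
  then have "finite (V m)" by (rule finite_subset) simp
  then obtain k where k: "infinite (V k)" "finite (V (Suc k))"
    using inf unfolding V0[symmetric] by (induction m) auto
  have sub: "V (Suc k) \<subseteq> V k"
  proof
    fix y assume "y \<in> V (Suc k)"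
    then obtain x where x: "x \<in> carrier G" "y = x [^] (p ^ Suc k)" "y [^] p = \<one>" by (auto simp: V_def)
    then have "y = (x [^] p) [^] (p ^ k)" by (simp add: nat_pow_pow)
    with x show "y \<in> V k" unfolding V_def by blast
  qed
  obtain e where e: "\<And>i::nat. e i \<in> V k" and
    indep: "\<And>h c. h \<in> hom free_nat G \<Longrightarrow> (\<And>i. h (frag_of i) = e i) \<Longrightarrow> h c \<in> V (Suc k) \<Longrightarrow>
      \<exists>d. c = frag_cmul (int p) d"
    using independent_sequence_modulo_finite[OF p V k(1) _ V k(2) sub]
    by (smt (verit) V_def mem_Collect_eq)
  have "\<forall>i. \<exists>x. x \<in> carrier G \<and> e i = x [^] (p ^ k)" using e by (auto simp: V_def)
  then obtain x where x: "\<And>i. x i \<in> carrier G" "\<And>i. e i = x i [^] (p ^ k)" by metis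
  obtain h where hom: "h \<in> hom free_nat G" and hx: "\<And>i. h (frag_of i) = x i"
    using free_nat_hom_obtain[of x] x(1) by blast
  note car = free_nat_hom(1)[OF hom]
  have npow: "h (frag_cmul (int n) c) = h c [^] n" for n c
    by (simp add: free_nat_hom[OF hom] int_pow_int)
  have hom': "(\<lambda>c. h c [^] (p ^ k)) \<in> hom free_nat G"
    by (rule homI) (auto simp: free_nat_hom[OF hom] nat_pow_distrib)
  have tor: "h c [^] (p ^ Suc k) = \<one>" for c
  proof -
    have "Poly_Mapping.keys c \<subseteq> UNIV" by simp
    then show ?thesis
    proof (induction c rule: frag_induction)
      case (one i)
      have "e i [^] p = \<one>" using e by (auto simp: V_def)
      then show ?case using x by (simp add: hx nat_pow_pow mult.commute)
    qed (simp_all add: free_nat_hom[OF hom] nat_pow_distrib nat_pow_inv del: power_Suc)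
  qed
  \<comment> \<open>Powers of \<open>p\<close> are split off one at a time: if \<open>c = p\<^sup>j d\<close> and \<open>h c \<in> p\<^bsup>k+1\<^esup> G\<close> with \<open>j \<le> k\<close>, then
    \<open>p\<^sup>k h d \<in> V (Suc k)\<close>, and independence gives \<open>p dvd d\<close>.\<close>
  have "\<exists>d. c = frag_cmul (int (p ^ j)) d"
    if hc: "h c \<in> (\<lambda>x. x [^] (p ^ Suc k)) ` carrier G" and "j \<le> Suc k" for c j
    using that(2)
  proof (induction j)
    case 0
    show ?case by (rule exI[of _ c]) simp
  next
    case (Suc j)
    then obtain d where d: "c = frag_cmul (int (p ^ j)) d" by auto
    obtain g where g: "g \<in> carrier G" "h c = g [^] (p ^ Suc k)" using hc by blast
    have "h d [^] (p ^ k) = (h d [^] (p ^ j)) [^] (p ^ (k - j))"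
      using Suc.prems car by (simp add: nat_pow_pow power_add[symmetric])
    also have "\<dots> = h c [^] (p ^ (k - j))" unfolding d npow ..
    also have "\<dots> = (g [^] (p ^ (k - j))) [^] (p ^ Suc k)"
      using g by (simp add: nat_pow_pow mult.commute)
    finally have "h d [^] (p ^ k) \<in> (\<lambda>x. x [^] (p ^ Suc k)) ` carrier G" using g by blast
    moreover have "(h d [^] (p ^ k)) [^] p = \<one>"
      using tor[of d] car by (simp add: nat_pow_pow mult.commute)
    ultimately have "h d [^] (p ^ k) \<in> V (Suc k)" by (simp add: V_def)
    then obtain d' where "d = frag_cmul (int p) d'" using indep[OF hom'] x hx by auto
    then have "c = frag_cmul (int (p ^ Suc j)) d'" by (simp add: d mult.commute)
    then show ?case by blast
  qed
  then have "pure_bounded_free p k h"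
    using hom tor unfolding pure_bounded_free_def by blast
  then show ?thesis by (rule that)
qed

section \<open>Dependence in groups of finite torsion-free rank\<close>

lemma generate_insert_subset:
  assumes "B \<subseteq> carrier G" "b \<in> carrier G"
  shows "generate G (insert b B) \<subseteq> generate G B <#> generate G {b}"
proof -
  have B: "subgroup (generate G B) G" and b: "subgroup (generate G {b}) G"
    using assms by (auto intro!: generate_is_subgroup)
  have "insert b B \<subseteq> generate G B <#> generate G {b}"
    using set_mult_left_subset[OF B b] set_mult_right_subset[OF B b]
      generate.incl[of _ B G] generate.incl[of b "{b}" G] by blast
  then show ?thesis using generate_subgroup_incl mult_subgroups[OF B b] by blast
qed

text \<open>
  A sequence in a finitely generated abelian group satisfies a nontrivial integer relation. The proof
  eliminates one generator at a time, without fractions.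
\<close>

lemma generate_relation:
  fixes x :: "nat \<Rightarrow> 'a"
  assumes "finite B" "B \<subseteq> carrier G" "\<And>i. x i \<in> generate G B"
  obtains c where "c \<noteq> 0"
    "\<forall>h \<in> hom free_nat G. (\<forall>i. h (frag_of i) = x i) \<longrightarrow> h c = \<one>"
proof -
  have "\<exists>c. c \<noteq> 0 \<and> (\<forall>h \<in> hom free_nat G. (\<forall>i. h (frag_of i) = x i) \<longrightarrow> h c = \<one>)"
    using assms
  proof (induction B arbitrary: x rule: finite_induct)
    case empty
    then have "x 0 = \<one>" by (simp add: generate_empty)
    then show ?case by (metis frag_of_nonzero)
  next
    case (insert b B)
    have b: "b \<in> carrier G" and B: "B \<subseteq> carrier G" using insert.prems by auto
    have gc: "generate G B \<subseteq> carrier G" by (rule generate_incl[OF B])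
    have gs: "subgroup (generate G B) G" by (rule generate_is_subgroup[OF B])
    have "\<exists>y a. y \<in> generate G B \<and> x i = y \<otimes> b [^] (a::int)" for i
    proof -
      have "x i \<in> generate G B <#> generate G {b}"
        using insert.prems(2) generate_insert_subset[OF B b] by blast
      then show ?thesis using b by (auto simp: set_mult_def generate_pow)
    qed
    then obtain y a where y: "\<And>i. y i \<in> generate G B" "\<And>i. x i = y i \<otimes> b [^] (a i :: int)"
      by metis
    have yc: "y i \<in> carrier G" for i using y(1) gc by blast
    show ?case
    proof (cases "\<forall>i. a i = 0")
      case True
      then have "x i \<in> generate G B" for i using y yc by simp
      then show ?thesis using insert.IH[of x] B by blast
    next
      case False
      then obtain k where k: "a k \<noteq> 0" by blast
      \<comment> \<open>\<open>w i\<close> is the combination of \<open>x (i + k + 1)\<close> and \<open>x k\<close> in which \<open>b\<close> cancels; the indices beyond \<open>k\<close>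
        ensure that relations among the \<open>w i\<close> yield nontrivial relations among the \<open>x i\<close>.\<close>
      define j where "j i = frag_cmul (a k) (frag_of (i + k + 1)) - frag_cmul (a (i + k + 1)) (frag_of k)"
        for i
      define w where "w i = y (i + k + 1) [^] a k \<otimes> inv (y k [^] a (i + k + 1))" for i
      have "w i \<in> generate G B" for i
        unfolding w_def using y(1) gs
        by (intro subgroup.m_closed[OF gs] subgroup.m_inv_closed[OF gs] subgroup_int_pow_closed)
      then obtain c where c: "c \<noteq> 0"
        "\<And>h. h \<in> hom free_nat G \<Longrightarrow> (\<And>i. h (frag_of i) = w i) \<Longrightarrow> h c = \<one>"
        using insert.IH[of w] B by blast
      have "h (frag_extend j c) = \<one>"
        if h: "h \<in> hom free_nat G" "\<And>i. h (frag_of i) = x i" for h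
      proof (rule c(2)[OF free_nat_hom_comp[OF h(1)]])
        fix i
        have "h (j i) = (y (i + k + 1) \<otimes> b [^] a (i + k + 1)) [^] a k
            \<otimes> inv ((y k \<otimes> b [^] a k) [^] a (i + k + 1))"
          by (simp add: j_def free_nat_hom[OF h(1)] h(2) y(2)[symmetric])
        also have "\<dots> = w i"
          using yc b by (simp add: w_def int_pow_distrib int_pow_pow inv_mult m_ac mult.commute)
        finally show "h (frag_extend j (frag_of i)) = w i" by simp
      qed
      moreover have "frag_extend j c \<noteq> 0"
      proof
        assume 0: "frag_extend j c = 0"
        have "Poly_Mapping.keys c \<subseteq> UNIV" by simp
        then have "poly_mapping.lookup (frag_extend j c) (i + k + 1) = a k * poly_mapping.lookup c i" for i
          by (induction c rule: frag_induction)
            (auto simp: frag_extend_diff lookup_minus j_def right_diff_distrib)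
        then have "c = 0" using 0 k by (intro poly_mapping_eqI) auto
        with c(1) show False by blast
      qed
      ultimately show ?thesis by blast
    qed
  qed
  then show ?thesis using that by blast
qed

lemma max_int_independent_multiple:
  assumes B: "finite B" "max_int_independent G B" and x: "x \<in> carrier G"
  obtains n :: int where "n \<noteq> 0" "x [^] n \<in> generate G B"
proof (cases "x \<in> B")
  case True
  then show ?thesis using that[of 1] x generate.incl[of x B G] by (simp add: int_pow_1)
next
  case False
  have ind: "int_independent G B" and Bc: "B \<subseteq> carrier G"
    using B by (auto simp: max_int_independent_def int_independent_def)
  have "\<not> int_independent G (insert x B)"
    using B(2) False unfolding max_int_independent_def by blast
  then obtain F c y where F: "finite F" "F \<subseteq> insert x B"
    "finprod G (\<lambda>x. x [^] (c x :: int)) F = \<one>" and y: "y \<in> F" "c y \<noteq> 0"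
    using x Bc unfolding int_independent_def by blast
  let ?f = "\<lambda>x. x [^] (c x :: int)"
  have Fc: "F \<subseteq> carrier G" using F x Bc by blast
  have pi: "?f \<in> F - {x} \<rightarrow> carrier G" using Fc by auto
  have xF: "x \<in> F"
  proof (rule ccontr)
    assume "x \<notin> F"
    then have "F \<subseteq> B" using F by blast
    then show False using ind F y unfolding int_independent_def by blast
  qed
  have split: "?f x \<otimes> finprod G ?f (F - {x}) = \<one>"
    using finprod_insert[of "F - {x}" x ?f] F pi x xF by (simp add: insert_absorb)
  show ?thesis
  proof (cases "c x = 0")
    case True
    then have "finprod G ?f (F - {x}) = \<one>" using split pi by simp
    moreover have "F - {x} \<subseteq> B" "finite (F - {x})" using F by auto
    ultimately have "\<forall>y\<in>F - {x}. c y = 0" using ind unfolding int_independent_def by blast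
    then show ?thesis using y True by blast
  next
    case False
    have gs: "subgroup (generate G B) G" by (rule generate_is_subgroup[OF Bc])
    have "finprod G ?f E \<in> generate G B" if "finite E" "E \<subseteq> B" for E
      using that
    proof (induction E rule: finite_induct)
      case empty
      then show ?case using gs by (simp add: subgroup.one_closed)
    next
      case (insert e E)
      then have "?f \<in> E \<rightarrow> carrier G" "e \<in> carrier G" using Bc by auto
      moreover have "?f e \<in> generate G B"
        using insert.prems gs generate.incl[of e B G] by (intro subgroup_int_pow_closed) auto
      ultimately show ?case using insert gs by (simp add: subgroup.m_closed)
    qed
    moreover have "F - {x} \<subseteq> B" "finite (F - {x})" using F by auto
    ultimately have "finprod G ?f (F - {x}) \<in> generate G B" by blast
    moreover have "?f x = inv (finprod G ?f (F - {x}))"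
      using split pi x by (simp add: inv_equality)
    ultimately have "?f x \<in> generate G B" using gs by (simp add: subgroup.m_inv_closed)
    then show ?thesis using that False by blast
  qed
qed

lemma max_int_independent_relation:
  assumes B: "finite B" "max_int_independent G B" and h: "h \<in> hom free_nat G"
  obtains c where "c \<noteq> 0" "h c = \<one>"
proof -
  have Bc: "B \<subseteq> carrier G" using B by (auto simp: max_int_independent_def int_independent_def)
  have "\<exists>n::int. n \<noteq> 0 \<and> h (frag_of i) [^] n \<in> generate G B" for i
    using max_int_independent_multiple[OF B free_nat_hom(1)[OF h]] by blast
  then obtain n where n: "\<And>i. n i \<noteq> (0::int)" "\<And>i. h (frag_of i) [^] n i \<in> generate G B" by metis
  obtain c where c: "c \<noteq> 0" "\<forall>g \<in> hom free_nat G.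
      (\<forall>i. g (frag_of i) = h (frag_of i) [^] n i) \<longrightarrow> g c = \<one>"
    by (rule generate_relation[of B "\<lambda>i. h (frag_of i) [^] n i", OF B(1) Bc n(2)])
  let ?j = "frag_extend (\<lambda>i. frag_cmul (n i) (frag_of i))"
  have "\<forall>i. h (?j (frag_of i)) = h (frag_of i) [^] n i"
    by (simp only: frag_extend_of free_nat_hom(4)[OF h] simp_thms)
  from mp[OF bspec[OF c(2) free_nat_hom_comp[OF h]] this] have "h (?j c) = \<one>" .
  moreover have "?j c \<noteq> 0"
  proof
    assume 0: "?j c = 0"
    have "Poly_Mapping.keys c \<subseteq> UNIV" by simp
    then have "poly_mapping.lookup (?j c) i = n i * poly_mapping.lookup c i" for i
      by (induction c rule: frag_induction)
        (auto simp: frag_extend_diff lookup_minus right_diff_distrib)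
    then have "c = 0" using 0 n by (intro poly_mapping_eqI) auto
    with c(1) show False by blast
  qed
  ultimately show ?thesis by (rule that[rotated])
qed

lemma torsion_subgroupE:
  assumes "x \<in> torsion_subgroup G"
  obtains n :: nat where "n > 0" "x [^] n = \<one>"
  using assms unfolding torsion_subgroup_def by blast

lemma torsion_subgroup_is_subgroup: "subgroup (torsion_subgroup G) G"
proof (rule subgroupI)
  show "torsion_subgroup G \<subseteq> carrier G" by (auto simp: torsion_subgroup_def)
  have "\<one> \<in> torsion_subgroup G" by (auto simp: torsion_subgroup_def intro: exI[of _ 1])
  then show "torsion_subgroup G \<noteq> {}" by blast
  show "inv a \<in> torsion_subgroup G" if "a \<in> torsion_subgroup G" for a
    using that by (auto simp: torsion_subgroup_def nat_pow_inv)
  show "a \<otimes> b \<in> torsion_subgroup G" if ab: "a \<in> torsion_subgroup G" "b \<in> torsion_subgroup G" for a b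
  proof -
    from ab obtain m n :: nat where "m > 0" "n > 0" "a [^] m = \<one>" "b [^] n = \<one>"
      and ab: "a \<in> carrier G" "b \<in> carrier G"
      by (auto simp: torsion_subgroup_def)
    moreover have "(a \<otimes> b) [^] (m * n) = (a [^] m) [^] n \<otimes> (b [^] n) [^] m"
      using ab by (simp add: nat_pow_pow nat_pow_distrib mult.commute)
    ultimately show ?thesis
      by (auto simp: torsion_subgroup_def intro!: exI[of _ "m * n"])
  qed
qed

lemma torsion_subgroup_normal: "torsion_subgroup G \<lhd> G"
  using torsion_subgroup_is_subgroup by (rule subgroup_imp_normal)

lemma torsion_subgroup_int_powI:
  assumes "x \<in> carrier G" "x [^] (n::int) = \<one>" "n \<noteq> 0"
  shows "x \<in> torsion_subgroup G"
proof -
  have "x [^] nat \<bar>n\<bar> = x [^] \<bar>n\<bar>" using int_pow_int[of G x "nat \<bar>n\<bar>"] by simp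
  also have "\<dots> = \<one>" using assms by (simp add: abs_if int_pow_neg)
  finally show ?thesis using assms by (auto simp: torsion_subgroup_def intro!: exI[of _ "nat \<bar>n\<bar>"])
qed

text \<open>
  The form in which finite rank is used: every sequence satisfies a nontrivial integer relation. The
  relation holds modulo torsion at first and exactly after taking a multiple.
\<close>

lemma finite_rank_relation:
  assumes "finite_torsion_free_rank G" and h: "h \<in> hom free_nat G"
  obtains c where "c \<noteq> 0" "h c = \<one>"
proof -
  interpret N: normal "torsion_subgroup G" G by (rule torsion_subgroup_normal)
  interpret Q: comm_group "G Mod torsion_subgroup G"
    by (rule abelian_FactGroup[OF torsion_subgroup_is_subgroup])
  obtain B where "finite B" "max_int_independent (G Mod torsion_subgroup G) B"
    using assms(1) by (auto simp: finite_torsion_free_rank_def)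
  moreover have "(\<lambda>c. torsion_subgroup G #> h c) \<in> hom free_nat (G Mod torsion_subgroup G)"
    using Group.hom_compose[OF h N.r_coset_hom_Mod] by (simp add: comp_def)
  ultimately obtain c where c: "c \<noteq> 0" "torsion_subgroup G #> h c = \<one>\<^bsub>G Mod torsion_subgroup G\<^esub>"
    using Q.max_int_independent_relation by blast
  then have "h c \<in> torsion_subgroup G"
    using free_nat_hom(1)[OF h] rcos_self[OF _ torsion_subgroup_is_subgroup, of "h c"] by simp
  then obtain n :: nat where n: "n > 0" "h c [^] n = \<one>" by (rule torsion_subgroupE)
  show ?thesis
  proof
    show "frag_cmul (int n) c \<noteq> 0" using n c by simp
    show "h (frag_cmul (int n) c) = \<one>" using n by (simp add: free_nat_hom[OF h] int_pow_int)
  qed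
qed

text \<open>
  The first element \<open>y 0\<close> of an infinite chain of successive preimages under \<open>\<phi>\<close> is torsion if \<open>\<phi>\<close> kills
  it. Applying \<open>\<phi>\<close> to a relation among the \<open>y i\<close> shifts it backwards, and after finitely many steps only
  a multiple of \<open>y 0\<close> is left.
\<close>

lemma kernel_orbit_torsion:
  assumes rank: "finite_torsion_free_rank G" and \<phi>: "\<phi> \<in> hom G G"
    and y: "\<And>i. y i \<in> carrier G" "\<And>i. \<phi> (y (Suc i)) = y i" "\<phi> (y 0) = \<one>"
  shows "y 0 \<in> torsion_subgroup G"
proof -
  interpret \<phi>: group_hom G G \<phi> using \<phi> by unfold_locales
  obtain h where h: "h \<in> hom free_nat G" "\<And>i. h (frag_of i) = y i"
    using free_nat_hom_obtain[of y] y(1) by blast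
  have hc: "\<phi> (h c) = h (unshift c)" for c
  proof (rule free_nat_hom_eqI[of "\<lambda>c. \<phi> (h c)" "\<lambda>c. h (unshift c)"])
    show "(\<lambda>c. \<phi> (h c)) \<in> hom free_nat G" using Group.hom_compose[OF h(1) \<phi>] by (simp add: comp_def)
    show "(\<lambda>c. h (unshift c)) \<in> hom free_nat G" by (rule free_nat_hom_comp[OF h(1)])
    show "\<phi> (h (frag_of i)) = h (unshift (frag_of i))" for i
      unfolding h(2) frag_extend_of using y(2)[of "i - 1"] y(3)
      by (cases i) (auto simp: h(2) free_nat_hom[OF h(1)])
  qed
  have "y 0 \<in> torsion_subgroup G"
    if "\<forall>i\<ge>n. poly_mapping.lookup c i = 0" "c \<noteq> 0" "h c = \<one>" for n c
    using that
  proof (induction n arbitrary: c)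
    case 0
    then show ?case by (metis le0 lookup_zero poly_mapping_eqI)
  next
    case (Suc n)
    show ?case
    proof (cases "unshift c = 0")
      case True
      then have c: "c = frag_cmul (poly_mapping.lookup c 0) (frag_of 0)"
        using shift_unshift[of c] by simp
      have "h c = y 0 [^] poly_mapping.lookup c 0"
        by (subst c) (simp only: free_nat_hom[OF h(1)] h(2))
      moreover have "poly_mapping.lookup c 0 \<noteq> 0" using c Suc.prems(2) by auto
      ultimately show ?thesis using Suc.prems(3) y(1) by (metis torsion_subgroup_int_powI)
    next
      case False
      have "h (unshift c) = \<one>" using hc[of c] Suc.prems(3) by simp
      moreover have "\<forall>i\<ge>n. poly_mapping.lookup (unshift c) i = 0"
        using Suc.prems(1) by (simp add: lookup_unshift)
      ultimately show ?thesis using Suc.IH[of "unshift c"] False by blast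
    qed
  qed
  moreover obtain c where "c \<noteq> 0" "h c = \<one>" by (rule finite_rank_relation[OF rank h(1)])
  moreover obtain n where "\<forall>i\<ge>n. poly_mapping.lookup c i = 0" using eventually_zero_lookup by blast
  ultimately show ?thesis by simp
qed

text \<open>
  In a relation among the \<open>\<phi>\<^sup>i(x)\<close> the coefficient of \<open>x\<close> can be assumed nonzero, because injectivity of
  \<open>\<phi>\<close> allows cancelling \<open>\<phi>\<close> from it; then it expresses a multiple of \<open>x\<close> as an element of \<open>\<phi>(H)\<close>.
\<close>

lemma injective_multiple_in_image:
  assumes rank: "finite_torsion_free_rank G" and \<phi>: "\<phi> \<in> hom G G"
    and H: "subgroup H G" "\<phi> ` H \<subseteq> H" "inj_on \<phi> H" and x: "x \<in> H"
  obtains n :: int where "n \<noteq> 0" "x [^] n \<in> \<phi> ` H"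
proof -
  interpret \<phi>: group_hom G G \<phi> using \<phi> by unfold_locales
  note Hc = subgroup.mem_carrier[OF H(1)]
  have orb: "(\<phi> ^^ i) x \<in> H" for i using x H(2) by (induction i) auto
  obtain h where h: "h \<in> hom free_nat G" "\<And>i. h (frag_of i) = (\<phi> ^^ i) x"
    using free_nat_hom_obtain[of "\<lambda>i. (\<phi> ^^ i) x"] orb Hc by blast
  have hc: "\<phi> (h c) = h (shift c)" for c
  proof (rule free_nat_hom_eqI[of "\<lambda>c. \<phi> (h c)" "\<lambda>c. h (shift c)"])
    show "(\<lambda>c. \<phi> (h c)) \<in> hom free_nat G" using Group.hom_compose[OF h(1) \<phi>] by (simp add: comp_def)
    show "(\<lambda>c. h (shift c)) \<in> hom free_nat G" by (rule free_nat_hom_comp[OF h(1)])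
    show "\<phi> (h (frag_of i)) = h (shift (frag_of i))" for i
      unfolding h(2) frag_extend_of by simp
  qed
  have hH: "h c \<in> H" for c
  proof -
    have "Poly_Mapping.keys c \<subseteq> UNIV" by simp
    then show ?thesis
      by (induction c rule: frag_induction)
        (auto simp: free_nat_hom[OF h(1)] h(2) orb H(1) subgroup.one_closed subgroup.m_closed
          subgroup.m_inv_closed)
  qed
  have "\<exists>n::int. n \<noteq> 0 \<and> x [^] n \<in> \<phi> ` H"
    if "\<forall>i\<ge>n. poly_mapping.lookup c i = 0" "c \<noteq> 0" "h c = \<one>" for n c
    using that
  proof (induction n arbitrary: c)
    case 0
    then show ?case by (metis le0 lookup_zero poly_mapping_eqI)
  next
    case (Suc n)
    let ?a = "poly_mapping.lookup c 0"
    have "h c = x [^] ?a \<otimes> \<phi> (h (unshift c))"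
      by (subst shift_unshift[of c]) (simp only: free_nat_hom[OF h(1)] h(2) hc funpow_0)
    then have rel: "x [^] ?a \<otimes> \<phi> (h (unshift c)) = \<one>" using Suc.prems(3) by simp
    show ?case
    proof (cases "?a = 0")
      case True
      then have "\<phi> (h (unshift c)) = \<phi> \<one>" using rel free_nat_hom(1)[OF h(1)] by simp
      then have "h (unshift c) = \<one>"
        using H(3) hH subgroup.one_closed[OF H(1)] by (metis inj_onD)
      moreover have "\<forall>i\<ge>n. poly_mapping.lookup (unshift c) i = 0"
        using Suc.prems(1) by (simp add: lookup_unshift)
      moreover have "unshift c \<noteq> 0"
        using shift_unshift[of c] True Suc.prems(2) by auto
      ultimately show ?thesis using Suc.IH[of "unshift c"] by blast
    next
      case False
      have "x [^] ?a = inv (\<phi> (h (unshift c)))"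
        using rel x Hc free_nat_hom(1)[OF h(1)] by (simp add: inv_equality)
      also have "\<dots> = \<phi> (inv (h (unshift c)))" using free_nat_hom(1)[OF h(1)] by simp
      finally have "x [^] ?a \<in> \<phi> ` H" using hH H(1) by (simp add: subgroup.m_inv_closed)
      then show ?thesis using False by blast
    qed
  qed
  then show ?thesis using finite_rank_relation[OF rank h(1)] eventually_zero_lookup that by metis
qed

section \<open>Comparing the two kinds of exponent\<close>

lemma hom_funpow: "\<phi> \<in> hom G G \<Longrightarrow> \<phi> ^^ n \<in> hom G G"
proof (induction n)
  case 0
  show ?case by (rule homI) auto
next
  case (Suc n)
  then show ?case using Group.hom_compose[of "\<phi> ^^ n" G G \<phi> G] by (simp only: funpow.simps)
qed

lemma endomorphism_facts:
  assumes "\<phi> \<in> hom G G"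
  shows "x \<in> carrier G \<Longrightarrow> \<phi> x \<in> carrier G" "\<phi> \<one> = \<one>"
    "x \<in> carrier G \<Longrightarrow> y \<in> carrier G \<Longrightarrow> \<phi> (x \<otimes> y) = \<phi> x \<otimes> \<phi> y"
    "x \<in> carrier G \<Longrightarrow> \<phi> (x [^] (k::nat)) = \<phi> x [^] k"
    "x \<in> carrier G \<Longrightarrow> \<phi> (inv x) = inv (\<phi> x)"
    "subgroup H G \<Longrightarrow> subgroup (\<phi> ` H) G"
proof -
  interpret \<phi>: group_hom G G \<phi> using assms by unfold_locales
  show "x \<in> carrier G \<Longrightarrow> \<phi> x \<in> carrier G" "\<phi> \<one> = \<one>"
    "x \<in> carrier G \<Longrightarrow> y \<in> carrier G \<Longrightarrow> \<phi> (x \<otimes> y) = \<phi> x \<otimes> \<phi> y"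
    "x \<in> carrier G \<Longrightarrow> \<phi> (x [^] (k::nat)) = \<phi> x [^] k"
    "x \<in> carrier G \<Longrightarrow> \<phi> (inv x) = inv (\<phi> x)"
    by (simp_all add: \<phi>.hom_nat_pow)
  show "subgroup H G \<Longrightarrow> subgroup (\<phi> ` H) G" by (rule \<phi>.subgroup_img_is_subgroup)
qed

lemma finite_bounded_torsion:
  assumes fin: "\<And>p::nat. Factorial_Ring.prime p \<Longrightarrow> finite {x \<in> carrier G. x [^] p = \<one>}"
    and "n > 0"
  shows "finite {x \<in> carrier G. x [^] (n::nat) = \<one>}"
  using \<open>n > 0\<close>
proof (induction n rule: less_induct)
  case (less n)
  show ?case
  proof (cases "n = 1")
    case True
    have "{x \<in> carrier G. x [^] n = \<one>} \<subseteq> {\<one>}" by (auto simp: True)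
    then show ?thesis by (rule finite_subset) simp
  next
    case False
    then obtain p where p: "Factorial_Ring.prime p" "p dvd n" using prime_factor_nat by blast
    then obtain m where m: "n = p * m" by blast
    have m0: "m > 0" using less.prems m by simp
    moreover have "m < n" using m m0 prime_gt_1_nat[OF p(1)] by simp
    ultimately have fm: "finite {x \<in> carrier G. x [^] m = \<one>}" using less.IH by blast
    have fib: "finite {x \<in> carrier G. x [^] p = y}" for y
    proof (cases "\<exists>z \<in> carrier G. z [^] p = y")
      case True
      then obtain z where z: "z \<in> carrier G" "z [^] p = y" by blast
      have "{x \<in> carrier G. x [^] p = y} \<subseteq> (\<lambda>t. z \<otimes> t) ` {x \<in> carrier G. x [^] p = \<one>}"
      proof
        fix x assume x: "x \<in> {x \<in> carrier G. x [^] p = y}"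
        then have "x = z \<otimes> (inv z \<otimes> x)" "(inv z \<otimes> x) [^] p = \<one>" "inv z \<otimes> x \<in> carrier G"
          using z by (auto simp: nat_pow_distrib nat_pow_inv)
        then show "x \<in> (\<lambda>t. z \<otimes> t) ` {x \<in> carrier G. x [^] p = \<one>}" by blast
      qed
      then show ?thesis using fin[OF p(1)] finite_surj by blast
    next
      case False
      then have "{x \<in> carrier G. x [^] p = y} = {}" by blast
      then show ?thesis by (simp only: finite.emptyI)
    qed
    have "{x \<in> carrier G. x [^] n = \<one>} \<subseteq>
        (\<Union>y \<in> {x \<in> carrier G. x [^] m = \<one>}. {x \<in> carrier G. x [^] p = y})"
    proof
      fix x assume "x \<in> {x \<in> carrier G. x [^] n = \<one>}"
      then have x: "x \<in> carrier G" "(x [^] p) [^] m = \<one>" by (simp_all add: m nat_pow_pow)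
      then show "x \<in> (\<Union>y \<in> {x \<in> carrier G. x [^] m = \<one>}. {x \<in> carrier G. x [^] p = y})"
        by (intro UN_I[of "x [^] p"]) simp_all
    qed
    then show ?thesis using fm fib finite_subset by (meson finite_UN_I)
  qed
qed

lemma divisible_mod_torsion_iff:
  "divisible_group (G Mod torsion_subgroup G) \<longleftrightarrow>
     (\<forall>x \<in> carrier G. \<forall>k::nat. k > 0 \<longrightarrow>
        (\<exists>g \<in> carrier G. \<exists>t \<in> torsion_subgroup G. x = g [^] k \<otimes> t))"
proof -
  let ?T = "torsion_subgroup G"
  note T = torsion_subgroup_is_subgroup
  have eq: "?T #> g = ?T #> x \<longleftrightarrow> (\<exists>t \<in> ?T. x = g \<otimes> t)"
    if "g \<in> carrier G" "x \<in> carrier G" for g x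
  proof
    assume "?T #> g = ?T #> x"
    then have "x \<in> ?T #> g" using rcos_self[OF that(2) T] by simp
    then show "\<exists>t \<in> ?T. x = g \<otimes> t"
      using that subgroup.mem_carrier[OF T] by (auto simp: r_coset_def m_comm)
  next
    assume "\<exists>t \<in> ?T. x = g \<otimes> t"
    then have "x \<in> ?T #> g"
      using that subgroup.mem_carrier[OF T] by (auto simp: r_coset_def m_comm)
    then show "?T #> g = ?T #> x" using repr_independence that T by blast
  qed
  show ?thesis
    unfolding divisible_group_def carrier_FactGroup
    by (simp add: normal.FactGroup_pow[OF torsion_subgroup_normal] eq)
qed

lemma SH_exponent_imp_ScoH_exponent:
  assumes rank: "finite_torsion_free_rank G"
    and fin: "\<And>n::nat. n > 0 \<Longrightarrow> finite {x \<in> carrier G. x [^] n = \<one>}"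
    and div: "divisible_group (G Mod torsion_subgroup G)"
    and \<phi>: "\<phi> \<in> hom G G" and n: "SH_exponent G \<phi> n"
  shows "ScoH_exponent G \<phi> n"
proof -
  define H where "H = (\<phi> ^^ n) ` carrier G"
  note f = endomorphism_facts[OF \<phi>] and fn = endomorphism_facts[OF hom_funpow[OF \<phi>]]
  have H: "subgroup H G" unfolding H_def by (rule fn(6)[OF subgroup_self])
  note Hc = subgroup.mem_carrier[OF H]
  have \<phi>H: "\<phi> ` H \<subseteq> H"
    using f(1) by (auto simp: H_def funpow_swap1)
  have inj: "inj_on \<phi> H" using n by (simp add: SH_exponent_def H_def)
  have I: "subgroup (\<phi> ` H) G" by (rule f(6)[OF H])
  \<comment> \<open>The torsion of \<open>H\<close> lies in the image, as \<open>\<phi>\<close> permutes the finite group \<open>K\<close> of elements killed by \<open>N\<close>.\<close>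
  have tors: "t \<in> \<phi> ` H" if t: "t \<in> H" "t \<in> torsion_subgroup G" for t
  proof -
    obtain N :: nat where N: "N > 0" "t [^] N = \<one>" using t(2) by (rule torsion_subgroupE)
    define K where "K = {x \<in> H. x [^] N = \<one>}"
    have "K \<subseteq> {x \<in> carrier G. x [^] N = \<one>}" using Hc by (auto simp: K_def)
    then have "finite K" using fin[OF N(1)] finite_subset by blast
    moreover have "\<phi> ` K \<subseteq> K"
      using \<phi>H Hc f(2) by (auto simp: K_def f(4)[symmetric])
    moreover have "inj_on \<phi> K" using inj by (rule inj_on_subset) (auto simp: K_def)
    ultimately have "\<phi> ` K = K" by (rule endo_inj_surj)
    moreover have "t \<in> K" using t N by (simp add: K_def)
    ultimately show ?thesis by (auto simp: K_def)
  qed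
  have "H \<subseteq> \<phi> ` H"
  proof
    fix x assume x: "x \<in> H"
    obtain i :: int where i: "i \<noteq> 0" "x [^] i \<in> \<phi> ` H"
      by (rule injective_multiple_in_image[OF rank \<phi> H \<phi>H inj x])
    define k where "k = nat \<bar>i\<bar>"
    have k: "k > 0" using i by (simp add: k_def)
    have "x [^] k = x [^] \<bar>i\<bar>" using int_pow_int[of G x k] by (simp add: k_def)
    also have "\<dots> \<in> \<phi> ` H"
      using i x Hc subgroup.m_inv_closed[OF I i(2)] by (simp add: abs_if int_pow_neg)
    finally obtain h where h: "h \<in> H" "x [^] k = \<phi> h" by blast
    then obtain g where g: "g \<in> carrier G" "h = (\<phi> ^^ n) g" by (auto simp: H_def)
    obtain g' t where g': "g' \<in> carrier G" "t \<in> torsion_subgroup G" "g = g' [^] k \<otimes> t"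
      using div g(1) k unfolding divisible_mod_torsion_iff by blast
    have tc: "t \<in> carrier G" using g'(2) by (simp add: torsion_subgroup_def)
    define u where "u = (\<phi> ^^ n) g'"
    have u: "u \<in> H" using g' by (simp add: u_def H_def)
    have hu: "h = u [^] k \<otimes> (\<phi> ^^ n) t" using g g' tc by (simp add: u_def fn)
    define w where "w = \<phi> ((\<phi> ^^ n) t)"
    have wc: "w \<in> carrier G" using tc by (simp add: w_def f fn)
    obtain N :: nat where N: "N > 0" "t [^] N = \<one>" using g'(2) by (rule torsion_subgroupE)
    have wN: "w [^] N = \<one>"
      using tc N by (simp add: w_def f(4)[symmetric] fn(4)[symmetric] fn(1) fn(2) f(2))
    \<comment> \<open>\<open>x\<close> and \<open>\<phi> u\<close> differ by a torsion element of \<open>H\<close>.\<close>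
    define z where "z = x \<otimes> inv (\<phi> u)"
    have uc: "\<phi> u \<in> carrier G" "x \<in> carrier G" using u x \<phi>H Hc by auto
    have zH: "z \<in> H" using x u \<phi>H H by (simp add: z_def subgroup.m_closed subgroup.m_inv_closed image_subset_iff)
    have "x [^] k = \<phi> u [^] k \<otimes> w"
      using h hu u Hc tc by (simp add: w_def f fn)
    then have "z [^] k = w"
      using uc wc by (simp add: z_def nat_pow_distrib nat_pow_inv m_ac)
    then have "z [^] (k * N) = \<one>" using wN Hc[OF zH] by (simp add: nat_pow_pow[symmetric])
    then have "z \<in> torsion_subgroup G"
      using Hc[OF zH] k N unfolding torsion_subgroup_def by (auto intro!: exI[of _ "k * N"])
    then have "z \<in> \<phi> ` H" using zH tors by blast
    then have "z \<otimes> \<phi> u \<in> \<phi> ` H" using u by (intro subgroup.m_closed[OF I]) auto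
    then show "x \<in> \<phi> ` H" using uc by (simp add: z_def)
  qed
  then have eq: "\<phi> ` H = H" using \<phi>H by blast
  have "(\<phi> ^^ m) ` carrier G = H" if "m \<ge> n" for m
    using that
  proof (induction m rule: dec_induct)
    case (step m)
    have "(\<phi> ^^ Suc m) ` carrier G = \<phi> ` ((\<phi> ^^ m) ` carrier G)" by (simp add: image_comp)
    then show ?case using step.IH eq by simp
  qed (simp add: H_def)
  moreover have "0 < n" using n by (simp add: SH_exponent_def)
  ultimately show ?thesis unfolding ScoH_exponent_def by (metis order_refl)
qed

text \<open>
  The assumption \<open>split\<close> says that \<open>p\<^sup>m G = p\<^bsup>2m\<^esup> G\<close> has no \<open>p\<close>-torsion for some \<open>m\<close>, so that \<open>G\<close> is the direct
  sum of \<open>p\<^sup>m G\<close> and \<open>G[p\<^sup>m]\<close>.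
\<close>

lemma ScoH_exponent_imp_SH_exponent:
  assumes rank: "finite_torsion_free_rank G"
    and fin: "\<And>n::nat. n > 0 \<Longrightarrow> finite {x \<in> carrier G. x [^] n = \<one>}"
    and split: "\<And>p::nat. Factorial_Ring.prime p \<Longrightarrow> \<exists>m.
      (\<forall>x \<in> carrier G. \<exists>y \<in> carrier G. x [^] (p ^ m) = (y [^] (p ^ m)) [^] (p ^ m)) \<and>
      (\<forall>x \<in> carrier G. (x [^] (p ^ m)) [^] p = \<one> \<longrightarrow> x [^] (p ^ m) = \<one>)"
    and \<phi>: "\<phi> \<in> hom G G" and n: "ScoH_exponent G \<phi> n"
  shows "SH_exponent G \<phi> n"
proof -
  define H where "H = (\<phi> ^^ n) ` carrier G"
  note f = endomorphism_facts[OF \<phi>] and fn = endomorphism_facts[OF hom_funpow[OF \<phi>]]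
  have H: "subgroup H G" unfolding H_def by (rule fn(6)[OF subgroup_self])
  note Hc = subgroup.mem_carrier[OF H]
  have "\<phi> ` H = (\<phi> ^^ Suc n) ` carrier G" by (simp add: H_def image_comp)
  also have "\<dots> = H" using n unfolding ScoH_exponent_def H_def by (metis le_Suc_eq order_refl)
  finally have \<phi>H: "\<phi> ` H = H" .
  have ker_torsion: "x \<in> torsion_subgroup G" if x: "x \<in> H" "\<phi> x = \<one>" for x
  proof -
    have surj: "\<exists>v. v \<in> H \<and> \<phi> v = u" if "u \<in> H" for u using that \<phi>H by (metis imageE)
    have "\<exists>y. \<forall>i::nat. (y i \<in> H \<and> (i = 0 \<longrightarrow> y i = x)) \<and> \<phi> (y (Suc i)) = y i"
      by (rule dependent_nat_choice) (use x surj in auto)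
    then obtain y where y: "\<And>i. y i \<in> H" "y 0 = x" "\<And>i. \<phi> (y (Suc i)) = y i" by blast
    have "y 0 \<in> torsion_subgroup G"
      using kernel_orbit_torsion[OF rank \<phi>, of y] y Hc x by simp
    then show ?thesis using y(2) by simp
  qed
  have no_p: "x = \<one>"
    if p: "Factorial_Ring.prime (p::nat)" and x: "x \<in> H" "\<phi> x = \<one>" "x [^] p = \<one>" for p x
  proof -
    obtain m where m: "\<And>x. x \<in> carrier G \<Longrightarrow> \<exists>y \<in> carrier G. x [^] (p ^ m) = (y [^] (p ^ m)) [^] (p ^ m)"
      and tf: "\<And>x. x \<in> carrier G \<Longrightarrow> (x [^] (p ^ m)) [^] p = \<one> \<Longrightarrow> x [^] (p ^ m) = \<one>"
      using split[OF p] by blast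
    have tf': "x [^] (p ^ m) = \<one>" if "x \<in> carrier G" "(x [^] (p ^ m)) [^] (p ^ k) = \<one>" for x k
      using that(2)
    proof (induction k)
      case 0
      then show ?case using that(1) by simp
    next
      case (Suc k)
      have "((x [^] (p ^ k)) [^] (p ^ m)) [^] p = \<one>"
        using Suc.prems that(1) by (simp add: nat_pow_pow mult_ac)
      then have "(x [^] (p ^ k)) [^] (p ^ m) = \<one>" using tf that(1) by blast
      then show ?case using Suc.IH that(1) by (simp add: nat_pow_pow mult.commute)
    qed
    define B where "B = {b \<in> carrier G. b [^] (p ^ m) = \<one>}"
    have decomp: "\<exists>d \<in> carrier G. \<exists>b \<in> B. g = d [^] (p ^ m) \<otimes> b" if g: "g \<in> carrier G" for g
    proof -
      obtain y where y: "y \<in> carrier G" "g [^] (p ^ m) = (y [^] (p ^ m)) [^] (p ^ m)" using m[OF g] by blast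
      have "inv (y [^] (p ^ m)) \<otimes> g \<in> B" using y g by (simp add: B_def nat_pow_distrib nat_pow_inv)
      moreover have "g = y [^] (p ^ m) \<otimes> (inv (y [^] (p ^ m)) \<otimes> g)" using y g by simp
      ultimately show ?thesis using y(1) by blast
    qed
    \<comment> \<open>Elements of \<open>p\<close>-power order in the image of \<open>\<psi>\<close> come from \<open>B = G[p\<^sup>m]\<close>, because \<open>\<psi>\<close> maps
      the component in \<open>p\<^sup>m G\<close> to \<open>p\<^sup>m G\<close>, which has no \<open>p\<close>-torsion.\<close>
    have bounded: "\<psi> g \<in> \<psi> ` B"
      if \<psi>: "\<psi> \<in> hom G G" and g: "g \<in> carrier G" "\<psi> g [^] (p ^ k) = \<one>" for \<psi> g k
    proof -
      note fp = endomorphism_facts[OF \<psi>]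
      obtain d b where db: "d \<in> carrier G" "b \<in> B" "g = d [^] (p ^ m) \<otimes> b" using decomp[OF g(1)] by blast
      have bc: "b \<in> carrier G" "b [^] (p ^ m) = \<one>" using db(2) by (auto simp: B_def)
      have eq: "\<psi> g = \<psi> d [^] (p ^ m) \<otimes> \<psi> b" using db bc by (simp add: fp)
      have "\<psi> b [^] (p ^ (k + m)) = \<psi> (b [^] (p ^ m * p ^ k))"
        using bc(1) by (simp add: fp(4) power_add mult.commute)
      also have "b [^] (p ^ m * p ^ k) = (b [^] (p ^ m)) [^] (p ^ k)"
        using bc(1) by (simp only: nat_pow_pow)
      finally have b1: "\<psi> b [^] (p ^ (k + m)) = \<one>" using bc(2) fp(2) by simp
      have g1: "\<psi> g [^] (p ^ (k + m)) = \<one>"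
        using g fp by (simp add: power_add nat_pow_pow[symmetric])
      have "(\<psi> d [^] (p ^ m)) [^] (p ^ (k + m)) = \<one>"
        using g1 b1 db bc unfolding eq by (simp add: nat_pow_distrib fp(1))
      then have "\<psi> d [^] (p ^ m) = \<one>" using tf' fp(1) db(1) by blast
      then have "\<psi> g = \<psi> b" using eq bc fp(1) by simp
      then show ?thesis using db(2) by blast
    qed
    define K where "K = (\<phi> ^^ n) ` B"
    have "finite B" unfolding B_def using p by (intro fin) (simp add: prime_gt_0_nat)
    then have finK: "finite K" by (simp add: K_def)
    have "K \<subseteq> \<phi> ` K"
    proof
      fix y assume "y \<in> K"
      then obtain b where b: "b \<in> carrier G" "b [^] (p ^ m) = \<one>" "y = (\<phi> ^^ n) b"
        by (auto simp: K_def B_def)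
      then have "y \<in> \<phi> ` H" using \<phi>H by (auto simp: H_def)
      then obtain g where g: "g \<in> carrier G" "y = (\<phi> ^^ Suc n) g" by (auto simp: H_def)
      have "y [^] (p ^ m) = \<one>" using b by (simp add: fn(4)[symmetric] fn(2))
      then have "y \<in> (\<phi> ^^ Suc n) ` B"
        using bounded[OF hom_funpow[OF \<phi>] g(1), of "Suc n" m] g(2) by simp
      then show "y \<in> \<phi> ` K" by (auto simp: K_def)
    qed
    then have "inj_on \<phi> K" using finK by (metis card_image_le card_mono eq_card_imp_inj_on finite_imageI order_antisym)
    moreover have "x \<in> K"
    proof -
      obtain g where g: "g \<in> carrier G" "x = (\<phi> ^^ n) g" using x(1) by (auto simp: H_def)
      then show ?thesis
        using bounded[OF hom_funpow[OF \<phi>] g(1), of n 1] x(3) by (simp add: K_def)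
    qed
    moreover have "\<one> \<in> K" unfolding K_def B_def using fn(2) by (intro image_eqI[of _ _ \<one>]) auto
    ultimately show ?thesis using x(2) f(2) by (metis inj_onD)
  qed
  have ker: "x = \<one>" if x: "x \<in> H" "\<phi> x = \<one>" for x
  proof (rule ccontr)
    assume ne: "x \<noteq> \<one>"
    obtain N :: nat where N: "N > 0" "x [^] N = \<one>" using ker_torsion[OF x] by (rule torsion_subgroupE)
    \<comment> \<open>\<open>M\<close> is the order of \<open>x\<close>; if \<open>p\<close> is a prime factor of \<open>M\<close>, then \<open>(M / p) x\<close> has order \<open>p\<close>.\<close>
    define M where "M = (LEAST N. 0 < N \<and> x [^] (N::nat) = \<one>)"
    have M: "0 < M" "x [^] M = \<one>"
      using LeastI[of "\<lambda>N. 0 < N \<and> x [^] (N::nat) = \<one>" N] N by (auto simp: M_def)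
    have "M \<noteq> 1" using M ne Hc[OF x(1)] by auto
    then obtain p where p: "Factorial_Ring.prime p" "p dvd M" using prime_factor_nat by blast
    then obtain k where k: "M = k * p" by (metis dvd_def mult.commute)
    have "x [^] k = \<one>"
    proof (rule no_p[OF p(1)])
      show "x [^] k \<in> H" using x(1) H by (simp add: subgroup_nat_pow_closed)
      show "\<phi> (x [^] k) = \<one>" using x Hc by (simp add: f(4))
      show "(x [^] k) [^] p = \<one>" using M(2) Hc[OF x(1)] by (simp add: nat_pow_pow k)
    qed
    moreover have "k > 0" "k < M" using M(1) k prime_gt_1_nat[OF p(1)] by auto
    ultimately show False
      using not_less_Least[of k "\<lambda>N. 0 < N \<and> x [^] (N::nat) = \<one>"] by (simp add: M_def)
  qed
  have "inj_on \<phi> H"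
  proof (rule inj_onI)
    fix x y assume xy: "x \<in> H" "y \<in> H" "\<phi> x = \<phi> y"
    then have "\<phi> (x \<otimes> inv y) = \<one>" using Hc f by simp
    then have "x \<otimes> inv y = \<one>" using ker xy H by (simp add: subgroup.m_closed subgroup.m_inv_closed)
    then show "x = y" using xy Hc by (metis inv_mult_cancel(1) l_one)
  qed
  then show ?thesis using n by (simp add: SH_exponent_def ScoH_exponent_def H_def)
qed

section \<open>Consequences of the two chain conditions\<close>

lemma pow_hom: "(\<lambda>x. x [^] (k::nat)) \<in> hom G G"
  by (rule homI) (auto simp: nat_pow_distrib)

lemma pow_funpow: "x \<in> carrier G \<Longrightarrow> ((\<lambda>x. x [^] (k::nat)) ^^ n) x = x [^] (k ^ n)"
  by (induction n) (auto simp: nat_pow_pow mult.commute)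

lemma ScoH_pow_stable:
  assumes "strongly_co_Hopfian G"
  obtains m where "m > 0" "\<And>x. x \<in> carrier G \<Longrightarrow>
    \<exists>y \<in> carrier G. x [^] (k ^ m) = (y [^] (k ^ m)) [^] (k ^ m :: nat)"
proof -
  obtain m where m: "ScoH_exponent G (\<lambda>x. x [^] k) m"
    using assms pow_hom by (auto simp: strongly_co_Hopfian_def)
  have img: "((\<lambda>x. x [^] k) ^^ j) ` carrier G = (\<lambda>x. x [^] (k ^ j)) ` carrier G" for j
    by (intro image_cong refl pow_funpow)
  have eq: "(\<lambda>x. x [^] (k ^ m)) ` carrier G = (\<lambda>x. x [^] (k ^ (m + m))) ` carrier G"
    using m unfolding ScoH_exponent_def img by (metis le_add1)
  show ?thesis
  proof
    show "m > 0" using m by (simp add: ScoH_exponent_def)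
    fix x assume "x \<in> carrier G"
    then have "x [^] (k ^ m) \<in> (\<lambda>x. x [^] (k ^ (m + m))) ` carrier G" unfolding eq[symmetric] by blast
    then obtain y where "y \<in> carrier G" "x [^] (k ^ m) = y [^] (k ^ (m + m))" by blast
    then show "\<exists>y \<in> carrier G. x [^] (k ^ m) = (y [^] (k ^ m)) [^] (k ^ m)"
      by (metis nat_pow_pow power_add)
  qed
qed

text \<open>
  If \<open>k\<^sup>m x = k\<^bsup>2m\<^esup> y\<close>, then \<open>x - k\<^sup>m y\<close> is torsion and \<open>k\<^sup>m y\<close> is a multiple of \<open>k\<close>.
\<close>

lemma ScoH_imp_divisible_mod_torsion:
  assumes "strongly_co_Hopfian G"
  shows "divisible_group (G Mod torsion_subgroup G)"
  unfolding divisible_mod_torsion_iff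
proof (intro ballI allI impI)
  fix x and k :: nat assume x: "x \<in> carrier G" and k: "k > 0"
  obtain m where m: "m > 0" "\<And>x. x \<in> carrier G \<Longrightarrow>
      \<exists>y \<in> carrier G. x [^] (k ^ m) = (y [^] (k ^ m)) [^] (k ^ m)"
    using ScoH_pow_stable[OF assms, of k] by blast
  obtain y where y: "y \<in> carrier G" "x [^] (k ^ m) = (y [^] (k ^ m)) [^] (k ^ m)"
    using m(2)[OF x] by blast
  let ?g = "y [^] (k ^ (m - 1))"
  have g: "?g \<in> carrier G" "?g [^] k = y [^] (k ^ m)"
    using y m(1) by (auto simp: nat_pow_pow power_Suc2[symmetric] simp del: power_Suc)
  have "inv (?g [^] k) \<otimes> x \<in> carrier G" using x g(1) by simp
  moreover have "(inv (?g [^] k) \<otimes> x) [^] (k ^ m) = \<one>"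
    using x y g by (simp add: nat_pow_distrib nat_pow_inv)
  ultimately have "inv (?g [^] k) \<otimes> x \<in> torsion_subgroup G"
    using k unfolding torsion_subgroup_def by (auto intro!: exI[of _ "k ^ m"])
  moreover have "x = ?g [^] k \<otimes> (inv (?g [^] k) \<otimes> x)" using x y(1) g by simp
  ultimately show "\<exists>g \<in> carrier G. \<exists>t \<in> torsion_subgroup G. x = g [^] k \<otimes> t"
    using g(1) by blast
qed

text \<open>
  The elements of \<open>p\<close>-power order in a \<open>p\<close>-divisible group form a divisible subgroup, since
  multiplication by integers prime to \<open>p\<close> is always bijective on it.
\<close>

lemma reduced_p_divisible_imp_no_p_torsion:
  assumes red: "reduced_group G" and p: "Factorial_Ring.prime (p::nat)"
    and D: "subgroup D G" "\<And>x. x \<in> D \<Longrightarrow> \<exists>y \<in> D. y [^] p = x"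
    and x: "x \<in> D" "x [^] p = \<one>"
  shows "x = \<one>"
proof -
  define P where "P = {x \<in> D. \<exists>k. x [^] (p ^ k) = \<one>}"
  note Dc = subgroup.mem_carrier[OF D(1)]
  have P: "subgroup P G"
  proof (rule subgroupI)
    show "P \<subseteq> carrier G" using Dc by (auto simp: P_def)
    have "\<one> \<in> P" using subgroup.one_closed[OF D(1)] by (simp add: P_def)
    then show "P \<noteq> {}" by blast
    show "inv a \<in> P" if "a \<in> P" for a
      using that subgroup.m_inv_closed[OF D(1)] Dc by (fastforce simp: P_def nat_pow_inv)
    show "a \<otimes> b \<in> P" if "a \<in> P" "b \<in> P" for a b
    proof -
      from that obtain i j where ij: "a \<in> D" "b \<in> D" "a [^] (p ^ i) = \<one>" "b [^] (p ^ j) = \<one>"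
        by (auto simp: P_def)
      have "(a \<otimes> b) [^] (p ^ (i + j)) = (a [^] (p ^ i)) [^] (p ^ j) \<otimes> (b [^] (p ^ j)) [^] (p ^ i)"
        using ij(1,2) Dc by (simp add: nat_pow_distrib nat_pow_pow power_add mult.commute)
      then have "(a \<otimes> b) [^] (p ^ (i + j)) = \<one>" using ij by simp
      then show ?thesis using ij subgroup.m_closed[OF D(1)] by (auto simp: P_def)
    qed
  qed
  note Pc = subgroup.mem_carrier[OF P]
  have div: "\<exists>y \<in> P. y [^] n = x" if "n > 0" "x \<in> P" for n :: nat and x
    using that
  proof (induction n arbitrary: x rule: less_induct)
    case (less n)
    show ?case
    proof (cases "p dvd n")
      case True
      then obtain m where m: "n = m * p" by (metis dvd_def mult.commute)
      then have m': "0 < m" "m < n" using less.prems(1) prime_gt_1_nat[OF p] by auto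
      obtain k where k: "x \<in> D" "x [^] (p ^ k) = \<one>" using less.prems(2) by (auto simp: P_def)
      obtain d where d: "d \<in> D" "d [^] p = x" using D(2) k(1) by blast
      have "d [^] (p ^ Suc k) = \<one>" using d k Dc by (metis nat_pow_pow power_Suc)
      then have "d \<in> P" using d(1) unfolding P_def by blast
      then obtain y where y: "y \<in> P" "y [^] m = d" using less.IH m' by blast
      then have "y [^] n = x" using d(2) Pc by (simp add: m nat_pow_pow[symmetric])
      then show ?thesis using y(1) by blast
    next
      case False
      obtain k where k: "x \<in> D" "x [^] (p ^ k) = \<one>" using less.prems(2) by (auto simp: P_def)
      have "coprime (int n) (int (p ^ k))"
        using False p prime_imp_coprime[of p n] by (simp add: coprime_commute del: of_nat_power)
      then obtain u v where uv: "u * int n + v * int (p ^ k) = 1"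
        by (metis bezout_int coprime_iff_gcd_eq_1)
      have xc: "x \<in> carrier G" using k Dc by blast
      have xk: "x [^] int (p ^ k) = \<one>" using k by (simp only: int_pow_int)
      have "(x [^] u) [^] n = x [^] (u * int n)" using xc int_pow_int[of G "x [^] u" n] by (simp add: int_pow_pow)
      also have "\<dots> = x [^] (u * int n) \<otimes> (x [^] int (p ^ k)) [^] v" using xc xk by simp
      also have "\<dots> = x [^] (u * int n + v * int (p ^ k))"
        using xc by (simp only: int_pow_pow int_pow_mult mult.commute)
      also have "\<dots> = x" using uv xc by (simp only: int_pow_1)
      finally have "(x [^] u) [^] n = x" .
      moreover have "x [^] u \<in> P" using P less.prems(2) by (rule subgroup_int_pow_closed)
      ultimately show ?thesis by blast
    qed
  qed
  have "divisible_group (G\<lparr>carrier := P\<rparr>)"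
    unfolding divisible_group_def using div by (simp add: nat_pow_consistent[symmetric])
  then have "P = {\<one>}" using red P by (auto simp: reduced_group_def)
  moreover have "x \<in> P" using x by (auto simp: P_def intro!: exI[of _ 1])
  ultimately show ?thesis by blast
qed

lemma ScoH_pow_split:
  assumes red: "reduced_group G" and S: "strongly_co_Hopfian G" and p: "Factorial_Ring.prime (p::nat)"
  obtains m where
    "\<forall>x \<in> carrier G. \<exists>y \<in> carrier G. x [^] (p ^ m) = (y [^] (p ^ m)) [^] (p ^ m)"
    "\<forall>x \<in> carrier G. (x [^] (p ^ m)) [^] p = \<one> \<longrightarrow> x [^] (p ^ m) = \<one>"
proof -
  obtain m where m: "m > 0" "\<And>x. x \<in> carrier G \<Longrightarrow>
      \<exists>y \<in> carrier G. x [^] (p ^ m) = (y [^] (p ^ m)) [^] (p ^ m)"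
    using ScoH_pow_stable[OF S, of p] by blast
  let ?D = "(\<lambda>x. x [^] (p ^ m)) ` carrier G"
  have "x [^] (p ^ m) = \<one>" if x: "x \<in> carrier G" "(x [^] (p ^ m)) [^] p = \<one>" for x
  proof (rule reduced_p_divisible_imp_no_p_torsion[OF red p pow_image_subgroup])
    show "x [^] (p ^ m) \<in> ?D" using x by blast
    show "(x [^] (p ^ m)) [^] p = \<one>" by fact
    fix z assume "z \<in> ?D"
    then obtain w where "w \<in> carrier G" "z = w [^] (p ^ m)" by blast
    then obtain y where y: "y \<in> carrier G" "z = (y [^] (p ^ m)) [^] (p ^ m)" using m(2) by blast
    then have "z = ((y [^] (p ^ (m - 1))) [^] (p ^ m)) [^] p"
      using m(1) by (cases m) (auto simp: nat_pow_pow mult_ac)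
    then show "\<exists>y \<in> ?D. y [^] p = z" using y by blast
  qed
  with m(2) that show ?thesis by blast
qed

lemma finite_p_torsion:
  assumes p: "Factorial_Ring.prime (p::nat)" and "strongly_Hopfian G \<or> strongly_co_Hopfian G"
    and "\<forall>x \<in> carrier G. (x [^] (p ^ m)) [^] p = \<one> \<longrightarrow> x [^] (p ^ m) = \<one>"
  shows "finite {x \<in> carrier G. x [^] p = \<one>}"
proof (rule ccontr)
  assume "infinite {x \<in> carrier G. x [^] p = \<one>}"
  then obtain k h where "pure_bounded_free p k h"
    using infinite_p_torsion_imp_pure_bounded_free[OF p, of m] assms(3) by blast
  then show False
    using assms(2) pure_bounded_free_imp_not_SH[OF p] pure_bounded_free_imp_not_ScoH[OF p] by blast
qed

lemma SH_no_p_torsion: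
  assumes "strongly_Hopfian G"
  obtains m where "\<forall>x \<in> carrier G. (x [^] (p ^ m)) [^] (p::nat) = \<one> \<longrightarrow> x [^] (p ^ m) = \<one>"
proof -
  obtain m where m: "inj_on (\<lambda>x. x [^] p) (((\<lambda>x. x [^] p) ^^ m) ` carrier G)"
    using assms pow_hom by (auto simp: strongly_Hopfian_def SH_exponent_def)
  have img: "((\<lambda>x. x [^] p) ^^ m) ` carrier G = (\<lambda>x. x [^] (p ^ m)) ` carrier G"
    by (intro image_cong refl pow_funpow)
  have one: "\<one> \<in> (\<lambda>x. x [^] (p ^ m)) ` carrier G"
    by (rule subgroup.one_closed[OF pow_image_subgroup])
  show ?thesis
  proof (rule that, intro ballI impI)
    fix x assume x: "x \<in> carrier G" "(x [^] (p ^ m)) [^] p = \<one>"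
    have "x [^] (p ^ m) \<in> (\<lambda>x. x [^] (p ^ m)) ` carrier G" using x by blast
    then show "x [^] (p ^ m) = \<one>"
      using inj_onD[OF m[unfolded img], of "x [^] (p ^ m)" \<one>] one x(2) by simp
  qed
qed

lemma SH_imp_ScoH_exponent:
  assumes "finite_torsion_free_rank G" and S: "strongly_Hopfian G"
    and "divisible_group (G Mod torsion_subgroup G)" "\<phi> \<in> hom G G" "SH_exponent G \<phi> n"
  shows "ScoH_exponent G \<phi> n"
proof (rule SH_exponent_imp_ScoH_exponent[OF assms(1) _ assms(3-5)])
  have "finite {x \<in> carrier G. x [^] p = \<one>}" if p: "Factorial_Ring.prime (p::nat)" for p
  proof -
    obtain m where "\<forall>x \<in> carrier G. (x [^] (p ^ m)) [^] p = \<one> \<longrightarrow> x [^] (p ^ m) = \<one>"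
      by (rule SH_no_p_torsion[OF S])
    then show ?thesis using finite_p_torsion[OF p] S by blast
  qed
  then show "finite {x \<in> carrier G. x [^] n = \<one>}" if "n > 0" for n :: nat
    using finite_bounded_torsion that by blast
qed

lemma ScoH_imp_SH_exponent:
  assumes "finite_torsion_free_rank G" and red: "reduced_group G" and S: "strongly_co_Hopfian G"
    and "\<phi> \<in> hom G G" "ScoH_exponent G \<phi> n"
  shows "SH_exponent G \<phi> n"
proof (rule ScoH_exponent_imp_SH_exponent[OF assms(1) _ _ assms(4,5)])
  have "finite {x \<in> carrier G. x [^] p = \<one>}" if p: "Factorial_Ring.prime (p::nat)" for p
  proof -
    obtain m where "\<forall>x \<in> carrier G. (x [^] (p ^ m)) [^] p = \<one> \<longrightarrow> x [^] (p ^ m) = \<one>"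
      by (rule ScoH_pow_split[OF red S p])
    then show ?thesis using finite_p_torsion[OF p] S by blast
  qed
  then show "finite {x \<in> carrier G. x [^] n = \<one>}" if "n > 0" for n :: nat
    using finite_bounded_torsion that by blast
  show "\<exists>m. (\<forall>x \<in> carrier G. \<exists>y \<in> carrier G. x [^] (p ^ m) = (y [^] (p ^ m)) [^] (p ^ m)) \<and>
      (\<forall>x \<in> carrier G. (x [^] (p ^ m)) [^] p = \<one> \<longrightarrow> x [^] (p ^ m) = \<one>)"
    if p: "Factorial_Ring.prime p" for p :: nat
    by (rule ScoH_pow_split[OF red S p]) blast
qed

end

theorem proposition2p15:
  fixes G :: "('a, 'b) monoid_scheme"
  assumes "comm_group G"
    and "reduced_group G"
    and "finite_torsion_free_rank G"
  shows "(strongly_co_Hopfian G \<longleftrightarrow>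
            strongly_Hopfian G \<and> divisible_group (G Mod torsion_subgroup G)) \<and>
         (uniformly_strongly_co_Hopfian G \<longleftrightarrow>
            uniformly_strongly_Hopfian G \<and> divisible_group (G Mod torsion_subgroup G))"
proof -
  interpret comm_group G by fact
  let ?D = "divisible_group (G Mod torsion_subgroup G)"
  have to_SH: "\<And>\<phi> n. strongly_co_Hopfian G \<Longrightarrow> \<phi> \<in> hom G G \<Longrightarrow> ScoH_exponent G \<phi> n \<Longrightarrow>
      SH_exponent G \<phi> n"
    using ScoH_imp_SH_exponent assms(2,3) by blast
  have to_ScoH: "\<And>\<phi> n. strongly_Hopfian G \<Longrightarrow> ?D \<Longrightarrow> \<phi> \<in> hom G G \<Longrightarrow> SH_exponent G \<phi> n \<Longrightarrow>
      ScoH_exponent G \<phi> n"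
    using SH_imp_ScoH_exponent assms(3) by blast
  have U: "uniformly_strongly_co_Hopfian G \<Longrightarrow> strongly_co_Hopfian G"
      "uniformly_strongly_Hopfian G \<Longrightarrow> strongly_Hopfian G"
    by (auto simp: uniformly_strongly_co_Hopfian_def uniformly_strongly_Hopfian_def
        strongly_co_Hopfian_def strongly_Hopfian_def)
  have "strongly_co_Hopfian G \<longleftrightarrow> strongly_Hopfian G \<and> ?D"
  proof
    assume S: "strongly_co_Hopfian G"
    then have "strongly_Hopfian G" using to_SH unfolding strongly_co_Hopfian_def strongly_Hopfian_def by meson
    then show "strongly_Hopfian G \<and> ?D" using ScoH_imp_divisible_mod_torsion[OF S] by blast
  next
    assume "strongly_Hopfian G \<and> ?D"
    then show "strongly_co_Hopfian G"
      using to_ScoH unfolding strongly_co_Hopfian_def strongly_Hopfian_def by meson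
  qed
  moreover have "uniformly_strongly_co_Hopfian G \<longleftrightarrow> uniformly_strongly_Hopfian G \<and> ?D"
  proof
    assume S: "uniformly_strongly_co_Hopfian G"
    then have "uniformly_strongly_Hopfian G"
      using to_SH U(1) unfolding uniformly_strongly_co_Hopfian_def uniformly_strongly_Hopfian_def by meson
    then show "uniformly_strongly_Hopfian G \<and> ?D" using ScoH_imp_divisible_mod_torsion U(1) S by blast
  next
    assume "uniformly_strongly_Hopfian G \<and> ?D"
    then show "uniformly_strongly_co_Hopfian G"
      using to_ScoH U(2) unfolding uniformly_strongly_co_Hopfian_def uniformly_strongly_Hopfian_def by meson
  qed
  ultimately show ?thesis by blast
qed

end
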